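(* Let $n\ge1$, $K\ge1$ be integers and let $B\in\mathcal B$, where $$\mathcal B=\Big\{B\in[0,n]^K:\ B_i\ge\min\Big\{n,\ \sum_{j\neq i}\frac{n}{B_j}\Big\}\text{ for all } i\Big\}.$$ Let $\pi$ be the Unbalanced MOSS strategy with inputs $n$ and $B_1,\dots,B_K$ (defined in the context). Then in the $K$-armed stochastic bandit problem with $1$-subgaussian noise and horizon $n$, $$R^\pi_i\le 252\,B_i\qquad\text{for all } i\in\{1,\dots,K\}.$$
   Context: Stochastic bandit: there are $K$ arms with unknown mean vector $\mu\in\mathbb R^K$ satisfying $\sup_{i,j}(\mu_i-\mu_j)\le 1$. In each time step $t=1,\dots,n$ the learner chooses $I_t\in\{1,\dots,K\}$ based on past actions and observations and observes the reward $\mu_{I_t}+\eta_t$, where the noise $\eta_t$ is sampled independently from a $1$-subgaussian distribution which may depend on $I_t$. A random variable $X$ is $1$-subgaussian if $\mathbb E[\exp(\lambda X)]\le\exp(\lambda^2/2)$ for all $\lambda\in\mathbb R$. The expected pseudo-regret with respect to arm $i$ is $R^\pi_{\mu,i}=n\mu_i-\mathbb E\sum_{t=1}^n\mu_{I_t}$, and $R^\pi_i=\sup_\mu R^\pi_{\mu,i}$, the supremum being over all $\mu\in\mathbb R^K$ with $\sup_{i,j}(\mu_i-\mu_j)\le 1$. $T_i(t)$ is the number of times arm $i$ was chosen in rounds $1,\dots,t$; $\hat\mu_{i,s}$ is the empirical mean of the first $s$ rewards obtained from arm $i$, with $\hat\mu_{i,0}=0$. $\log_+(x)=\max\{0,\log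 x\}$. Unbalanced MOSS: set $n_i=n^2/B_i^2$ for all $i$; in each round $t=1,\dots,n$ choose $$I_t\in\operatorname*{arg\,max}_i\ \hat\mu_{i,T_i(t-1)}+\sqrt{\frac{4}{T_i(t-1)}\log_+\Big(\frac{n_i}{T_i(t-1)}\Big)}-\sqrt{\frac1{n_i}},$$ with ties broken arbitrarily, where the index is interpreted as $+\infty$ when $T_i(t-1)=0$. Convention: $n/0=+\infty$; an empty sum is $0$. *)

theory Defs
  imports "HOL-Probability.Probability"
begin

text \<open>
  Arms are the elements of a finite type, so the number of arms is the cardinality of that type.
  Rounds are numbered from 0: index \<open>t\<close> stands for round \<open>t + 1\<close>, and a history before
  index \<open>t\<close> is a function \<open>h\<close> on \<open>{0..<t}\<close> with \<open>h s = (chosen arm, observed reward)\<close>.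
\<close>

definition subgaussian1 :: "'w measure \<Rightarrow> ('w \<Rightarrow> real) \<Rightarrow> bool" where
  "subgaussian1 M X \<longleftrightarrow> X \<in> borel_measurable M \<and>
     (\<forall>c::real. (\<integral>\<^sup>+\<omega>. ennreal (exp (c * X \<omega>)) \<partial>M) \<le> ennreal (exp (c\<^sup>2 / 2)))"

definition noise_distribution :: "real measure \<Rightarrow> bool" where
  "noise_distribution D \<longleftrightarrow> prob_space D \<and> sets D = sets borel \<and> subgaussian1 D (\<lambda>x. x)"

definition mean_vectors :: "(real ^ 'k) set" where
  "mean_vectors = {\<mu>. \<forall>i j. \<mu> $ i - \<mu> $ j \<le> 1}"


section \<open>The bandit protocol\<close>

type_synonym 'k history = "nat \<Rightarrow> 'k \<times> real"

type_synonym 'k policy = "nat \<Rightarrow> 'k history \<Rightarrow> 'k pmf"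

definition obs_space :: "('k \<times> real) measure" where
  "obs_space = count_space UNIV \<Otimes>\<^sub>M borel"

definition hist_space :: "nat \<Rightarrow> 'k history measure" where
  "hist_space t = PiM {0..<t} (\<lambda>_. obs_space)"

text \<open>Policies may be randomised, so a deterministic policy is one with values \<open>return_pmf a\<close>.\<close>

definition is_policy :: "'k policy \<Rightarrow> bool" where
  "is_policy \<pi> \<longleftrightarrow> (\<forall>t a. (\<lambda>h. pmf (\<pi> t h) a) \<in> borel_measurable (hist_space t))"

text \<open>
  Conditional law of the next observation: given the history \<open>h\<close>, an arm \<open>a\<close> is drawn from
  \<open>\<pi> t h\<close>, and given \<open>a\<close> the reward is \<open>\<mu> $ a + x\<close> with fresh noise \<open>x\<close> drawn from \<open>D a\<close>.
\<close>

definition round_kernel ::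
  "'k policy \<Rightarrow> (real ^ 'k) \<Rightarrow> ('k \<Rightarrow> real measure) \<Rightarrow> nat \<Rightarrow> 'k history \<Rightarrow> ('k \<times> real) measure" where
  "round_kernel \<pi> \<mu> D t h =
     measure_pmf (\<pi> t h) \<bind> (\<lambda>a. distr (D a) obs_space (\<lambda>x. (a, \<mu> $ a + x)))"

text \<open>Law of the first \<open>n\<close> observations, started from the empty history.\<close>

definition hist_law ::
  "'k policy \<Rightarrow> (real ^ 'k) \<Rightarrow> ('k \<Rightarrow> real measure) \<Rightarrow> nat \<Rightarrow> 'k history measure" where
  "hist_law \<pi> \<mu> D n =
     Ionescu_Tulcea.C (round_kernel \<pi> \<mu> D) (\<lambda>_. obs_space) 0 n (\<lambda>_. undefined)"

lemma space_obs_space [simp]: "space obs_space = UNIV"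
  by (simp add: obs_space_def space_pair_measure)

lemma Ionescu_Tulcea_round_kernel:
  fixes \<pi> :: "'k::finite policy"
  assumes pol: "is_policy \<pi>" and noise: "\<And>a. noise_distribution (D a)"
  shows "Ionescu_Tulcea (round_kernel \<pi> \<mu> D) (\<lambda>_. obs_space)"
proof -
  have step: "distr (D a) obs_space (\<lambda>x. (a, \<mu> $ a + x)) \<in> space (prob_algebra obs_space)" for a
  proof -
    have [measurable_cong]: "sets (D a) = sets borel" and "prob_space (D a)"
      using noise[of a] by (auto simp: noise_distribution_def)
    moreover have "(\<lambda>x. (a, \<mu> $ a + x)) \<in> measurable (D a) obs_space"
      unfolding obs_space_def by measurable
    ultimately show ?thesis
      by (auto simp: space_prob_algebra intro: prob_space.prob_space_distr)
  qed
  have pi: "(\<lambda>h. measure_pmf (\<pi> t h)) \<in> measurable (hist_space t) (prob_algebra (count_space UNIV))" for t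
  proof (rule measurable_prob_algebraI)
    show "prob_space (measure_pmf (\<pi> t h))" for h
      by (rule prob_space_measure_pmf)
    show "(\<lambda>h. measure_pmf (\<pi> t h)) \<in> measurable (hist_space t) (subprob_algebra (count_space UNIV))"
    proof (rule measurable_subprob_algebra)
      show "subprob_space (measure_pmf (\<pi> t h))" for h
        by (rule measure_pmf.subprob_space_axioms)
      show "sets (measure_pmf (\<pi> t h)) = sets (count_space UNIV)" for h
        by simp
      fix A :: "'k set"
      have "(\<lambda>h. ennreal (\<Sum>a\<in>A. pmf (\<pi> t h) a)) \<in> borel_measurable (hist_space t)"
        using pol unfolding is_policy_def
        by (intro borel_measurable_sum measurable_compose[OF _ measurable_ennreal]) blast
      then show "(\<lambda>h. emeasure (measure_pmf (\<pi> t h)) A) \<in> borel_measurable (hist_space t)"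
        by (simp add: measure_pmf.emeasure_eq_measure measure_measure_pmf_finite)
    qed
  qed
  have kernel: "round_kernel \<pi> \<mu> D t \<in> measurable (hist_space t) (prob_algebra obs_space)" for t
    unfolding round_kernel_def
    by (rule measurable_bind_prob_space[OF pi[of t], where R=obs_space]) (use step in auto)
  show ?thesis
  proof (rule Ionescu_Tulcea.intro)
    show "round_kernel \<pi> \<mu> D t \<in> measurable (PiM {0..<t} (\<lambda>_. obs_space)) (subprob_algebra obs_space)" for t
      using measurable_prob_algebraD[OF kernel] by (simp add: hist_space_def)
  next
    fix t :: nat and h :: "'k history"
    assume "h \<in> space (PiM {0..<t} (\<lambda>_. obs_space))"
    then show "prob_space (round_kernel \<pi> \<mu> D t h)"
      using measurable_space[OF kernel, of h t] by (simp add: hist_space_def space_prob_algebra)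
  qed
qed


section \<open>Regret\<close>

definition pseudo_regret ::
  "nat \<Rightarrow> 'k policy \<Rightarrow> ('k \<Rightarrow> real measure) \<Rightarrow> (real ^ 'k) \<Rightarrow> 'k \<Rightarrow> real" where
  "pseudo_regret n \<pi> D \<mu> i =
     real n * \<mu> $ i - (\<integral>h. (\<Sum>t<n. \<mu> $ fst (h t)) \<partial>hist_law \<pi> \<mu> D n)"

text \<open>
  The noise distributions may vary with the mean vector (as for Bernoulli rewards), hence the
  argument of \<open>\<nu>\<close>. The supremum is taken in the extended reals, where it always exists.
\<close>

definition worst_regret ::
  "nat \<Rightarrow> 'k policy \<Rightarrow> ((real ^ 'k) \<Rightarrow> 'k \<Rightarrow> real measure) \<Rightarrow> 'k \<Rightarrow> ereal" where
  "worst_regret n \<pi> \<nu> i = (SUP \<mu>\<in>mean_vectors. ereal (pseudo_regret n \<pi> (\<nu> \<mu>) \<mu> i))"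


section \<open>Unbalanced MOSS\<close>

text \<open>The quotients are formed in the extended reals, so that \<open>n / 0 = \<infinity>\<close> for positive \<open>n\<close>.\<close>

definition admissible_bounds :: "nat \<Rightarrow> (real ^ 'k) set" where
  "admissible_bounds n = {B. \<forall>i. 0 \<le> B $ i \<and> B $ i \<le> real n \<and>
     min (ereal (real n)) (\<Sum>j\<in>UNIV - {i}. ereal (real n) / ereal (B $ j)) \<le> ereal (B $ i)}"

definition pulls :: "'k history \<Rightarrow> nat \<Rightarrow> 'k \<Rightarrow> nat" where
  "pulls h t i = card {s. s < t \<and> fst (h s) = i}"

text \<open>Mean of the first \<open>pulls h t i\<close> rewards of arm \<open>i\<close>; it is 0 if there are none, as \<open>x / 0 = 0\<close>.\<close>

definition emp_mean :: "'k history \<Rightarrow> nat \<Rightarrow> 'k \<Rightarrow> real" where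
  "emp_mean h t i = (\<Sum>s | s < t \<and> fst (h s) = i. snd (h s)) / real (pulls h t i)"

definition log_plus :: "real \<Rightarrow> real" where
  "log_plus x = max 0 (ln x)"

text \<open>
  \<open>umoss_n n B i\<close> is only meaningful for \<open>B $ i > 0\<close>. For \<open>B $ i = 0\<close> it stands for \<open>\<infinity>\<close>, which
  makes the index infinite; for admissible bounds this occurs only if there is a single arm.
\<close>

definition umoss_n :: "nat \<Rightarrow> (real ^ 'k) \<Rightarrow> 'k \<Rightarrow> real" where
  "umoss_n n B i = (real n)\<^sup>2 / (B $ i)\<^sup>2"

definition umoss_index :: "nat \<Rightarrow> (real ^ 'k) \<Rightarrow> nat \<Rightarrow> 'k history \<Rightarrow> 'k \<Rightarrow> ereal" where
  "umoss_index n B t h i =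
     (if pulls h t i = 0 \<or> B $ i = 0 then \<infinity>
      else ereal (emp_mean h t i
                  + sqrt (4 / real (pulls h t i) * log_plus (umoss_n n B i / real (pulls h t i)))
                  - sqrt (1 / umoss_n n B i)))"

text \<open>Ties may be broken in any (history dependent, possibly randomised) way.\<close>

definition unbalanced_MOSS :: "nat \<Rightarrow> (real ^ 'k) \<Rightarrow> 'k policy \<Rightarrow> bool" where
  "unbalanced_MOSS n B \<pi> \<longleftrightarrow> is_policy \<pi> \<and>
     (\<forall>t<n. \<forall>h\<in>space (hist_space t).
        set_pmf (\<pi> t h) \<subseteq> {a. is_arg_max (umoss_index n B t h) (\<lambda>_. True) a})"

end

theory Submission
  imports Defs
begin

text \<open>
  Write \<open>\<epsilon>\<close> for \<open>B $ i / n\<close> and \<open>z\<close> for the largest amount by which the index of arm \<open>i\<close>, without the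
  shift \<open>\<epsilon>\<close>, ever falls below \<open>\<mu> $ i\<close>. Whenever an arm \<open>j\<close> with gap \<open>\<delta> > 2 * (z + \<epsilon>)\<close> is pulled again, its
  own unshifted index exceeds \<open>\<mu> $ j + \<delta> / 2 + B $ j / n\<close>. All deviations are controlled by Ville's
  inequality for the exponential supermartingale of an arm. Peeling over the number of pulls shows
  that the expectation of \<open>z\<close> is of order \<open>\<epsilon>\<close>, and summing tail bounds over the number of pulls shows
  that the exceptional pulls of arm \<open>j\<close> cost \<open>O(n / B $ j)\<close>: the shift \<open>B $ j / n\<close> absorbs the logarithm.
  Admissibility of \<open>B\<close> bounds the sum of the latter costs by \<open>B $ i\<close>.
\<close>

section \<open>Pull counts and centred reward sums along a history\<close>

definition deviation :: "(real ^ 'k) \<Rightarrow> 'k history \<Rightarrow> nat \<Rightarrow> 'k \<Rightarrow> real" where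
  "deviation \<mu> h t a = (\<Sum>s | s < t \<and> fst (h s) = a. snd (h s) - \<mu> $ a)"

lemma pulls_0 [simp]: "pulls h 0 a = 0"
  by (simp add: pulls_def)

lemma deviation_0 [simp]: "deviation \<mu> h 0 a = 0"
  by (simp add: deviation_def)

lemma rounds_Suc:
  "{s. s < Suc t \<and> fst (h s) = a} =
     (if fst (h t) = a then insert t {s. s < t \<and> fst (h s) = a} else {s. s < t \<and> fst (h s) = a})"
  by (auto simp: less_Suc_eq)

lemma pulls_Suc: "pulls h (Suc t) a = pulls h t a + (if fst (h t) = a then 1 else 0)"
  by (simp add: pulls_def rounds_Suc)

text \<open>A sum is tracked rather than an average: a pull of \<open>a\<close> then adds just the
  fresh noise of that round, as the exponential supermartingale requires.\<close>

lemma deviation_Suc: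
  "deviation \<mu> h (Suc t) a = deviation \<mu> h t a + (if fst (h t) = a then snd (h t) - \<mu> $ a else 0)"
  by (simp add: deviation_def rounds_Suc)

lemma pulls_le: "pulls h t a \<le> t"
  by (induction t) (auto simp: pulls_Suc)

lemma pulls_mono: "s \<le> t \<Longrightarrow> pulls h s a \<le> pulls h t a"
  by (induction rule: dec_induct) (auto simp: pulls_Suc)

text \<open>With the two congruences that follow, this shows that extending a history to
  \<open>h(t := y)\<close> leaves all statistics of the first \<open>t\<close> rounds
  unchanged.\<close>

lemma pulls_cong: "(\<And>s. s < t \<Longrightarrow> h s = h' s) \<Longrightarrow> pulls h t a = pulls h' t a"
  unfolding pulls_def by (rule arg_cong[where f=card]) auto

lemma deviation_cong: "(\<And>s. s < t \<Longrightarrow> h s = h' s) \<Longrightarrow> deviation \<mu> h t a = deviation \<mu> h' t a"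
  unfolding deviation_def by (intro sum.cong) auto

lemma emp_mean_cong:
  assumes "\<And>s. s < t \<Longrightarrow> h s = h' s"
  shows "emp_mean h t a = emp_mean h' t a"
proof -
  have "(\<Sum>s | s < t \<and> fst (h s) = a. snd (h s)) = (\<Sum>s | s < t \<and> fst (h' s) = a. snd (h' s))"
    using assms by (intro sum.cong) auto
  then show ?thesis
    using pulls_cong[OF assms] by (simp add: emp_mean_def)
qed

lemma emp_mean_eq:
  assumes "pulls h t a \<noteq> 0"
  shows "emp_mean h t a = \<mu> $ a + deviation \<mu> h t a / real (pulls h t a)"
proof -
  have "deviation \<mu> h t a =
      (\<Sum>s | s < t \<and> fst (h s) = a. snd (h s)) - (\<Sum>s | s < t \<and> fst (h s) = a. \<mu> $ a)"
    unfolding deviation_def by (rule sum_subtractf)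
  also have "(\<Sum>s | s < t \<and> fst (h s) = a. \<mu> $ a) = real (pulls h t a) * \<mu> $ a"
    unfolding pulls_def by (rule sum_constant)
  finally show ?thesis
    unfolding emp_mean_def using assms by (simp add: diff_divide_distrib)
qed

lemma sum_rounds_eq_pulls:
  fixes f :: "'k::finite \<Rightarrow> real"
  shows "(\<Sum>t<n. f (fst (h t))) = (\<Sum>a\<in>UNIV. f a * real (pulls h n a))"
proof (induction n)
  case (Suc n)
  have "(\<Sum>a\<in>UNIV. f a * real (pulls h (Suc n) a)) =
      (\<Sum>a\<in>UNIV. f a * real (pulls h n a) + (if fst (h n) = a then f a else 0))"
    by (intro sum.cong) (auto simp: pulls_Suc algebra_simps)
  also have "\<dots> = (\<Sum>a\<in>UNIV. f a * real (pulls h n a)) + f (fst (h n))"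
    by (simp only: sum.distrib) simp
  finally show ?case
    using Suc by simp
qed simp

section \<open>Measurability and integration of histories\<close>

lemma measurable_arm:
  assumes "s < t"
  shows "(\<lambda>h :: 'k history. fst (h s)) \<in> measurable (hist_space t) (count_space UNIV)"
proof -
  have "(\<lambda>h :: 'k history. h s) \<in> measurable (hist_space t) obs_space"
    unfolding hist_space_def using assms by (intro measurable_component_singleton) simp
  then have "(\<lambda>h :: 'k history. h s) \<in> measurable (hist_space t) (count_space UNIV \<Otimes>\<^sub>M borel)"
    unfolding obs_space_def .
  from measurable_fst'[OF this] show ?thesis .
qed

lemma measurable_reward:
  assumes "s < t"
  shows "(\<lambda>h :: 'k history. snd (h s)) \<in> borel_measurable (hist_space t)"
proof -
  have "(\<lambda>h :: 'k history. h s) \<in> measurable (hist_space t) obs_space"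
    unfolding hist_space_def using assms by (intro measurable_component_singleton) simp
  then have "(\<lambda>h :: 'k history. h s) \<in> measurable (hist_space t) (count_space UNIV \<Otimes>\<^sub>M borel)"
    unfolding obs_space_def .
  from measurable_snd'[OF this] show ?thesis .
qed

lemma measurable_pulls:
  fixes a :: "'k::finite"
  assumes "s \<le> t"
  shows "(\<lambda>h. pulls h s a) \<in> measurable (hist_space t) (count_space UNIV)"
  using assms
proof (induction s)
  case (Suc s)
  have arm: "(\<lambda>h. fst (h s)) \<in> measurable (hist_space t) (count_space (UNIV :: 'k set))"
    using Suc.prems by (intro measurable_arm) simp
  show ?case
    unfolding pulls_Suc
  proof (rule measurable_compose_countable[where f="\<lambda>k h. k + (if fst (h s) = a then 1 else 0)"])
    show "(\<lambda>h. k + (if fst (h s) = a then 1 else 0)) \<in> measurable (hist_space t) (count_space UNIV)"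
      for k :: nat
      by (rule measurable_compose[OF arm, where g="\<lambda>b. k + (if b = a then 1 else 0)"]) simp
    show "(\<lambda>h. pulls h s a) \<in> measurable (hist_space t) (count_space UNIV)"
      using Suc by simp
  qed
qed simp

lemma measurable_deviation:
  fixes a :: "'k::finite"
  assumes "s \<le> t"
  shows "(\<lambda>h. deviation \<mu> h s a) \<in> borel_measurable (hist_space t)"
  using assms
proof (induction s)
  case (Suc s)
  have arm: "(\<lambda>h. fst (h s)) \<in> measurable (hist_space t) (count_space (UNIV :: 'k set))"
    using Suc.prems by (intro measurable_arm) simp
  have reward: "(\<lambda>h :: 'k history. snd (h s)) \<in> borel_measurable (hist_space t)"
    using Suc.prems by (intro measurable_reward) simp
  have "Measurable.pred (hist_space t) (\<lambda>h. fst (h s) = a)"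
    by (rule measurable_compose[OF arm]) simp
  then have "(\<lambda>h. if fst (h s) = a then snd (h s) - \<mu> $ a else 0) \<in> borel_measurable (hist_space t)"
    by (intro measurable_If borel_measurable_diff borel_measurable_const reward) (simp add: pred_def)
  then show ?case
    unfolding deviation_Suc using Suc.IH Suc.prems by (intro borel_measurable_add) simp_all
qed simp

text \<open>Pull counts take countably many values, so it suffices that \<open>P\<close> is
  measurable in the deviation for each fixed count.\<close>

lemma measurable_pulls_deviation:
  fixes a :: "'k::finite" and P :: "nat \<Rightarrow> real \<Rightarrow> bool"
  assumes "s \<le> t" and P: "\<And>k. Measurable.pred borel (P k)"
  shows "Measurable.pred (hist_space t) (\<lambda>h. P (pulls h s a) (deviation \<mu> h s a))"
proof (rule measurable_compose_countable[where f="\<lambda>k h. P k (deviation \<mu> h s a)"])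
  show "Measurable.pred (hist_space t) (\<lambda>h. P k (deviation \<mu> h s a))" for k
    by (rule measurable_compose[OF measurable_deviation[OF assms(1)] P])
qed (rule measurable_pulls[OF assms(1)])

text \<open>All exceptional events of the analysis have this form: at some time up to the horizon,
  count and deviation of one arm stand in a bad relation.\<close>

lemma sets_ex_pulls_deviation:
  fixes a :: "'k::finite" and P :: "nat \<Rightarrow> real \<Rightarrow> bool"
  assumes P: "\<And>k. Measurable.pred borel (P k)"
  shows "{h \<in> space (hist_space n). \<exists>t\<le>n. P (pulls h t a) (deviation \<mu> h t a)} \<in> sets (hist_space n)"
proof -
  have "Measurable.pred (hist_space n) (\<lambda>h. \<exists>t\<in>{..n}. P (pulls h t a) (deviation \<mu> h t a))"
    by (intro pred_intros_finite measurable_pulls_deviation P) auto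
  moreover have "{h \<in> space (hist_space n). \<exists>t\<le>n. P (pulls h t a) (deviation \<mu> h t a)} =
      {h \<in> space (hist_space n). \<exists>t\<in>{..n}. P (pulls h t a) (deviation \<mu> h t a)}"
    by auto
  ultimately show ?thesis
    by (simp only: pred_def)
qed

section \<open>The history law of one fixed environment\<close>

locale bandit =
  fixes \<pi> :: "'k::finite policy" and \<mu> :: "real ^ 'k" and D :: "'k \<Rightarrow> real measure"
  assumes policy: "is_policy \<pi>" and noise: "\<And>a. noise_distribution (D a)"
begin

sublocale IT: Ionescu_Tulcea "round_kernel \<pi> \<mu> D" "\<lambda>_. obs_space"
  using policy noise by (rule Ionescu_Tulcea_round_kernel)

abbreviation "law \<equiv> hist_law \<pi> \<mu> D"

text \<open>The start history of \<open>hist_law\<close> is the only point of the product over no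
  rounds.\<close>

lemma empty_history: "(\<lambda>_. undefined) \<in> space (PiM {0..<0::nat} (\<lambda>_. obs_space))"
  by (simp add: space_PiM)

lemma prob_space_law: "prob_space (law t)"
  unfolding hist_law_def using empty_history by (rule IT.prob_space_C)

lemma space_law [simp]: "space (law t) = space (hist_space t)"
  unfolding hist_law_def hist_space_def using IT.space_C[OF empty_history] by simp

lemma sets_law [simp, measurable_cong]: "sets (law t) = sets (hist_space t)"
  unfolding hist_law_def hist_space_def using IT.sets_C[OF empty_history] by simp

lemma borel_measurable_law [simp]: "borel_measurable (law t) = borel_measurable (hist_space t)"
  by (rule measurable_cong_sets) auto

lemma measurable_noise [simp]: "measurable (D a) N = measurable borel N"
  using noise[of a] by (intro measurable_cong_sets) (auto simp: noise_distribution_def)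

lemma nn_integral_round_kernel:
  assumes f: "f \<in> borel_measurable obs_space"
  shows "(\<integral>\<^sup>+y. f y \<partial>round_kernel \<pi> \<mu> D t h) =
    (\<Sum>a\<in>UNIV. ennreal (pmf (\<pi> t h) a) * (\<integral>\<^sup>+x. f (a, \<mu> $ a + x) \<partial>D a))"
proof -
  have obs: "(\<lambda>x. (a, \<mu> $ a + x)) \<in> measurable (D a) obs_space" for a
    unfolding obs_space_def by simp
  have "distr (D a) obs_space (\<lambda>x. (a, \<mu> $ a + x)) \<in> space (subprob_algebra obs_space)" for a
    using noise[of a] obs
    by (auto simp: space_subprob_algebra noise_distribution_def
        intro!: prob_space_imp_subprob_space prob_space.prob_space_distr)
  then have "(\<integral>\<^sup>+y. f y \<partial>round_kernel \<pi> \<mu> D t h) =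
      (\<integral>\<^sup>+a. (\<integral>\<^sup>+y. f y \<partial>distr (D a) obs_space (\<lambda>x. (a, \<mu> $ a + x))) \<partial>measure_pmf (\<pi> t h))"
    unfolding round_kernel_def by (intro nn_integral_bind[where B=obs_space] f) auto
  also have "\<dots> = (\<integral>\<^sup>+a. (\<integral>\<^sup>+x. f (a, \<mu> $ a + x) \<partial>D a) \<partial>measure_pmf (\<pi> t h))"
    using f by (intro nn_integral_cong nn_integral_distr obs) simp
  also have "\<dots> = (\<Sum>a\<in>UNIV. (\<integral>\<^sup>+x. f (a, \<mu> $ a + x) \<partial>D a) * ennreal (pmf (\<pi> t h) a))"
    by (subst nn_integral_measure_pmf_support[where A=UNIV]) auto
  finally show ?thesis by (simp add: mult.commute)
qed

text \<open>Tower rule: the last round is integrated out conditionally on the past. Both inductions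
  over the number of rounds, for almost sure properties and for Ville's inequality, rest on
  it.\<close>

lemma nn_integral_law_Suc:
  assumes f: "f \<in> borel_measurable (hist_space (Suc t))"
  shows "(\<integral>\<^sup>+h. f h \<partial>law (Suc t)) =
    (\<integral>\<^sup>+h. (\<Sum>a\<in>UNIV. ennreal (pmf (\<pi> t h) a) * (\<integral>\<^sup>+x. f (h(t := (a, \<mu> $ a + x))) \<partial>D a)) \<partial>law t)"
proof -
  have "(\<integral>\<^sup>+h. f h \<partial>law (Suc t)) = (\<integral>\<^sup>+h. (\<integral>\<^sup>+h'. f h' \<partial>IT.eP t h) \<partial>law t)"
    unfolding hist_law_def IT.C.simps add_0
  proof (rule nn_integral_bind)
    show "f \<in> borel_measurable (PiM {0..<Suc t} (\<lambda>_. obs_space))"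
      using f by (simp add: hist_space_def)
    show "IT.eP t \<in> measurable (IT.C 0 t (\<lambda>_. undefined))
        (subprob_algebra (PiM {0..<Suc t} (\<lambda>_. obs_space)))"
      using IT.measurable_eP[of t] sets_law[of t]
      by (simp add: hist_law_def hist_space_def cong: measurable_cong_sets)
  qed
  also have "\<dots> = (\<integral>\<^sup>+h. (\<integral>\<^sup>+y. f (h(t := y)) \<partial>round_kernel \<pi> \<mu> D t h) \<partial>law t)"
    using f by (intro nn_integral_cong IT.nn_integral_eP) (auto simp: hist_space_def)
  also have "\<dots> = (\<integral>\<^sup>+h. (\<Sum>a\<in>UNIV. ennreal (pmf (\<pi> t h) a) *
      (\<integral>\<^sup>+x. f (h(t := (a, \<mu> $ a + x))) \<partial>D a)) \<partial>law t)"
  proof (intro nn_integral_cong nn_integral_round_kernel)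
    fix h assume "h \<in> space (law t)"
    then have "(\<lambda>y. h(t := y)) \<in> measurable obs_space (PiM {0..<Suc t} (\<lambda>_. obs_space))"
      by (intro measurable_fun_upd[where J="{0..<t}"]) (auto simp: hist_space_def)
    then show "(\<lambda>y. f (h(t := y))) \<in> borel_measurable obs_space"
      by (rule measurable_compose) (use f in \<open>simp add: hist_space_def\<close>)
  qed
  finally show ?thesis .
qed

text \<open>Induction over the rounds: an arm outside the support has weight 0, an arm in the
  support satisfies \<open>P\<close> by \<open>supp\<close>, and by \<open>cong\<close> what held
  for earlier rounds survives the extension of the history. It carries the index rule from single
  choices to whole histories.\<close>

lemma AE_law_arms:
  assumes meas: "\<And>s t a. s < t \<Longrightarrow> Measurable.pred (hist_space t) (\<lambda>h. P s h a)"
    and cong: "\<And>s h h' a. (\<And>u. u < s \<Longrightarrow> h u = h' u) \<Longrightarrow> P s h a = P s h' a"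
    and supp: "\<And>s h a. s < n \<Longrightarrow> h \<in> space (hist_space s) \<Longrightarrow> a \<in> set_pmf (\<pi> s h) \<Longrightarrow> P s h a"
  shows "AE h in law n. \<forall>s<n. P s h (fst (h s))"
proof -
  have pred: "Measurable.pred (hist_space t) (\<lambda>h. \<forall>s<t. P s h (fst (h s)))" for t
  proof -
    \<comment> \<open>The random arm is replaced by a quantifier over the finitely many arms, as
      \<open>P\<close> is known to be measurable only for a fixed arm.\<close>
    have "Measurable.pred (hist_space t) (\<lambda>h. \<forall>s\<in>{..<t}. \<exists>a. fst (h s) = a \<and> P s h a)"
    proof (intro pred_intros_finite pred_intros_countable pred_intros_logic meas)
      fix s and a :: 'k assume "s \<in> {..<t}"
      then have "(\<lambda>h. fst (h s)) \<in> measurable (hist_space t) (count_space (UNIV :: 'k set))"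
        by (intro measurable_arm) simp
      then show "Measurable.pred (hist_space t) (\<lambda>h. fst (h s) = a)"
        by (rule measurable_compose[where g="\<lambda>b. b = a"]) simp
    qed auto
    moreover have "(\<forall>s\<in>{..<t}. \<exists>a. fst (h s) = a \<and> P s h a) \<longleftrightarrow> (\<forall>s<t. P s h (fst (h s)))" for h
      by blast
    ultimately show ?thesis by (simp only:)
  qed
  have "t \<le> n \<Longrightarrow> AE h in law t. \<forall>s<t. P s h (fst (h s))" for t
  proof (induction t)
    case (Suc t)
    define good where "good h \<longleftrightarrow> (\<forall>s<Suc t. P s h (fst (h s)))" for h
    define bad where "bad = {h \<in> space (hist_space (Suc t)). \<not> good h}"
    have sets: "bad \<in> sets (hist_space (Suc t))"
      using pred[of "Suc t"] unfolding bad_def good_def by measurable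
    have "emeasure (law (Suc t)) bad = (\<integral>\<^sup>+h. indicator bad h \<partial>law (Suc t))"
      using sets by simp
    also have "\<dots> = (\<integral>\<^sup>+h. (\<Sum>a\<in>UNIV. ennreal (pmf (\<pi> t h) a) *
        (\<integral>\<^sup>+x. indicator bad (h(t := (a, \<mu> $ a + x))) \<partial>D a)) \<partial>law t)"
      by (intro nn_integral_law_Suc borel_measurable_indicator sets)
    also have "\<dots> = (\<integral>\<^sup>+h. 0 \<partial>law t)"
    proof (rule nn_integral_cong_AE)
      have "AE h in law t. \<forall>s<t. P s h (fst (h s))"
        using Suc by simp
      moreover have "AE h in law t. h \<in> space (hist_space t)"
        using AE_space[of "law t"] by simp
      ultimately show "AE h in law t. (\<Sum>a\<in>UNIV. ennreal (pmf (\<pi> t h) a) *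
        (\<integral>\<^sup>+x. indicator bad (h(t := (a, \<mu> $ a + x))) \<partial>D a)) = 0"
      proof eventually_elim
        case (elim h)
        have "ennreal (pmf (\<pi> t h) a) * (\<integral>\<^sup>+x. indicator bad (h(t := (a, \<mu> $ a + x))) \<partial>D a) = 0" for a
        proof (cases "a \<in> set_pmf (\<pi> t h)")
          case True
          have "P s (h(t := (a, y))) (fst ((h(t := (a, y))) s))" if "s < Suc t" for s y
          proof -
            have "P s (h(t := (a, y))) b = P s h b" for b
              by (rule cong) (use that in auto)
            then show ?thesis
              using that elim supp[OF _ elim(2) True] Suc.prems by (auto simp: less_Suc_eq)
          qed
          then have "good (h(t := (a, y)))" for y
            unfolding good_def by blast
          then have "indicator bad (h(t := (a, \<mu> $ a + x))) = (0 :: ennreal)" for x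
            by (simp add: bad_def)
          then show ?thesis by simp
        next
          case False
          then show ?thesis by (simp add: set_pmf_iff)
        qed
        then show ?case by (simp only: sum.neutral_const)
      qed
    qed
    finally have "bad \<in> null_sets (law (Suc t))"
      using sets by (simp add: null_sets_def)
    then have "AE h in law (Suc t). good h"
      by (rule AE_I') (auto simp: bad_def)
    then show ?case by (simp only: good_def)
  qed simp
  then show ?thesis by simp
qed

section \<open>A maximal inequality for the deviations\<close>

lemma nn_integral_exp_noise: "(\<integral>\<^sup>+x. ennreal (exp (c * x)) \<partial>D a) \<le> ennreal (exp (c\<^sup>2 / 2))"
  using noise[of a] by (simp add: noise_distribution_def subgaussian1_def)

text \<open>Supermartingale property: a pull of \<open>j\<close> multiplies \<open>W\<close> by
  \<open>exp (c * x - c\<^sup>2 / 2)\<close> with \<open>x\<close> the noise, of expectation at most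
  1 by subgaussianity. Any other arm leaves \<open>W\<close> unchanged, and the arm probabilities
  sum to 1.\<close>

lemma exp_deviation_step:
  fixes c :: real and j :: 'k
  defines "W \<equiv> \<lambda>h t. exp (c * deviation \<mu> h t j - c\<^sup>2 / 2 * real (pulls h t j))"
  shows "(\<Sum>a\<in>UNIV. ennreal (pmf (\<pi> t h) a) *
      (\<integral>\<^sup>+x. ennreal (W (h(t := (a, \<mu> $ a + x))) (Suc t)) \<partial>D a)) \<le> ennreal (W h t)"
proof -
  have W_nonneg: "0 \<le> W h t" for h t
    by (simp add: W_def)
  have W: "W (h(t := (a, y))) (Suc t) =
      W h t * (if a = j then exp (c * (y - \<mu> $ j)) * exp (- (c\<^sup>2 / 2)) else 1)" for a y
  proof -
    have "pulls (h(t := (a, y))) t j = pulls h t j"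
      "deviation \<mu> (h(t := (a, y))) t j = deviation \<mu> h t j"
      by (auto intro!: pulls_cong deviation_cong)
    then show ?thesis
      by (cases "a = j") (simp_all add: W_def pulls_Suc deviation_Suc mult_exp_exp, simp add: field_simps)
  qed
  have "(\<integral>\<^sup>+x. ennreal (W (h(t := (a, \<mu> $ a + x))) (Suc t)) \<partial>D a) \<le> ennreal (W h t)" for a
  proof (cases "a = j")
    case True
    have "(\<integral>\<^sup>+x. ennreal (W (h(t := (a, \<mu> $ a + x))) (Suc t)) \<partial>D a) =
        (\<integral>\<^sup>+x. ennreal (W h t * exp (- (c\<^sup>2 / 2))) * ennreal (exp (c * x)) \<partial>D a)"
      unfolding W using True
      by (intro nn_integral_cong) (simp add: mult_ac W_nonneg flip: ennreal_mult)
    also have "\<dots> = ennreal (W h t * exp (- (c\<^sup>2 / 2))) * (\<integral>\<^sup>+x. ennreal (exp (c * x)) \<partial>D a)"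
      by (rule nn_integral_cmult) simp
    also have "\<dots> \<le> ennreal (W h t * exp (- (c\<^sup>2 / 2))) * ennreal (exp (c\<^sup>2 / 2))"
      by (intro mult_left_mono nn_integral_exp_noise) simp
    also have "\<dots> = ennreal (W h t)"
      by (simp add: W_nonneg mult.assoc mult_exp_exp flip: ennreal_mult)
    finally show ?thesis .
  next
    case False
    have "emeasure (D a) (space (D a)) = 1"
      using noise[of a] by (intro prob_space.emeasure_space_1) (simp add: noise_distribution_def)
    then show ?thesis
      using False by (simp add: W)
  qed
  then have "(\<Sum>a\<in>UNIV. ennreal (pmf (\<pi> t h) a) *
      (\<integral>\<^sup>+x. ennreal (W (h(t := (a, \<mu> $ a + x))) (Suc t)) \<partial>D a)) \<le>
      (\<Sum>a\<in>UNIV. ennreal (pmf (\<pi> t h) a) * ennreal (W h t))"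
    by (intro sum_mono mult_left_mono) auto
  also have "\<dots> = ennreal (W h t)"
    by (simp add: sum_pmf_eq_1 flip: sum_distrib_right)
  finally show ?thesis .
qed


text \<open>A supermartingale started at 1 and frozen when it reaches \<open>A\<close> keeps
  expectation at most 1, and it equals \<open>A\<close> on the event in question, so Markov's
  inequality applies.\<close>

lemma Ville_deviation:
  fixes c :: real and j :: 'k
  defines "W \<equiv> \<lambda>h t. exp (c * deviation \<mu> h t j - c\<^sup>2 / 2 * real (pulls h t j))"
  assumes "0 < A"
  shows "emeasure (law n) {h \<in> space (hist_space n). \<exists>t\<le>n. A \<le> W h t} \<le> ennreal (1 / A)"
proof -
  have W_nonneg: "0 \<le> W h t" for h t
    by (simp add: W_def)
  have W_measurable: "(\<lambda>h. W h s) \<in> borel_measurable (hist_space t)" if "s \<le> t" for s t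
  proof -
    have "(\<lambda>h. real (pulls h s j)) \<in> borel_measurable (hist_space t)"
      by (rule measurable_compose[OF measurable_pulls[OF that], where g=real]) simp
    then have "(\<lambda>h. c * deviation \<mu> h s j - c\<^sup>2 / 2 * real (pulls h s j)) \<in> borel_measurable (hist_space t)"
      by (intro borel_measurable_diff borel_measurable_times borel_measurable_const measurable_deviation that)
    then show ?thesis
      unfolding W_def by (rule measurable_compose[where g=exp]) simp
  qed
  have hit_measurable: "Measurable.pred (hist_space t) (\<lambda>h. \<exists>s\<le>u. A \<le> W h s)" if "u \<le> t" for u t
  proof -
    have "Measurable.pred (hist_space t) (\<lambda>h. \<exists>s\<in>{..u}. A \<le> W h s)"
    proof (intro pred_intros_finite)
      fix s assume "s \<in> {..u}"
      then have "s \<le> t" using that by simp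
      show "Measurable.pred (hist_space t) (\<lambda>h. A \<le> W h s)"
        by (rule measurable_compose[OF W_measurable[OF \<open>s \<le> t\<close>], where g="\<lambda>x. A \<le> x"]) measurable
    qed simp
    moreover have "(\<exists>s\<in>{..u}. A \<le> W h s) \<longleftrightarrow> (\<exists>s\<le>u. A \<le> W h s)" for h
      by blast
    ultimately show ?thesis by (simp only:)
  qed
  \<comment> \<open>\<open>W\<close> frozen at level \<open>A\<close> from its first passage on.
    Since \<open>W\<close> is at least \<open>A\<close> at that moment, cutting off the overshoot
    only decreases the value, so the supermartingale inequality survives without an explicit
    stopping time.\<close>
  define U where "U t h = ennreal (if \<exists>s\<le>t. A \<le> W h s then A else W h t)" for t h
  have U_measurable: "U t \<in> borel_measurable (hist_space t)" for t
    unfolding U_def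
    by (intro measurable_compose[OF _ measurable_ennreal] measurable_If W_measurable borel_measurable_const
        hit_measurable[unfolded pred_def]) auto
  have W_upd: "W (h(t := y)) s = W h s" if "s \<le> t" for h t s y
  proof -
    have "pulls (h(t := y)) s j = pulls h s j" "deviation \<mu> (h(t := y)) s j = deviation \<mu> h s j"
      using that by (auto intro!: pulls_cong deviation_cong)
    then show ?thesis by (simp add: W_def)
  qed
  have "(\<integral>\<^sup>+h. U t h \<partial>law t) \<le> 1" for t
  proof (induction t)
    case 0
    have "U 0 h \<le> 1" for h
      by (simp add: U_def W_def)
    then have "(\<integral>\<^sup>+h. U 0 h \<partial>law 0) \<le> (\<integral>\<^sup>+h. 1 \<partial>law 0)"
      by (intro nn_integral_mono)
    then show ?case
      using prob_space.emeasure_space_1[OF prob_space_law[of 0]] by simp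
  next
    case (Suc t)
    have "(\<Sum>a\<in>UNIV. ennreal (pmf (\<pi> t h) a) * (\<integral>\<^sup>+x. U (Suc t) (h(t := (a, \<mu> $ a + x))) \<partial>D a)) \<le> U t h" for h
    proof (cases "\<exists>s\<le>t. A \<le> W h s")
      case True
      then obtain s where "s \<le> t" "A \<le> W h s" by blast
      then have "\<exists>s\<le>Suc t. A \<le> W (h(t := y)) s" for y
        by (intro exI[of _ s]) (simp add: W_upd)
      then have "U (Suc t) (h(t := y)) = ennreal A" for y
        by (simp only: U_def if_True)
      moreover have "emeasure (D a) (space (D a)) = 1" for a
        using noise[of a] by (intro prob_space.emeasure_space_1) (simp add: noise_distribution_def)
      ultimately have "(\<Sum>a\<in>UNIV. ennreal (pmf (\<pi> t h) a) *
          (\<integral>\<^sup>+x. U (Suc t) (h(t := (a, \<mu> $ a + x))) \<partial>D a)) = ennreal A"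
        by (simp add: sum_pmf_eq_1 flip: sum_distrib_right)
      then show ?thesis
        using True by (simp add: U_def)
    next
      case False
      then have "\<not> (\<exists>s\<le>t. A \<le> W (h(t := y)) s)" for y
        by (simp add: W_upd cong: conj_cong)
      then have "(if \<exists>s\<le>Suc t. A \<le> W (h(t := y)) s then A else W (h(t := y)) (Suc t)) \<le> W (h(t := y)) (Suc t)"
        for y
        by (simp only: le_Suc_eq conj_disj_distribR ex_disj_distrib) auto
      then have "U (Suc t) (h(t := y)) \<le> ennreal (W (h(t := y)) (Suc t))" for y
        unfolding U_def by (rule ennreal_leI)
      then have "(\<Sum>a\<in>UNIV. ennreal (pmf (\<pi> t h) a) *
          (\<integral>\<^sup>+x. U (Suc t) (h(t := (a, \<mu> $ a + x))) \<partial>D a)) \<le>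
          (\<Sum>a\<in>UNIV. ennreal (pmf (\<pi> t h) a) *
          (\<integral>\<^sup>+x. ennreal (W (h(t := (a, \<mu> $ a + x))) (Suc t)) \<partial>D a))"
        by (intro sum_mono mult_left_mono nn_integral_mono) auto
      also have "\<dots> \<le> ennreal (W h t)"
        unfolding W_def by (rule exp_deviation_step)
      also have "\<dots> = U t h"
        using False by (simp only: U_def if_False)
      finally show ?thesis .
    qed
    then have "(\<integral>\<^sup>+h. U (Suc t) h \<partial>law (Suc t)) \<le> (\<integral>\<^sup>+h. U t h \<partial>law t)"
      unfolding nn_integral_law_Suc[OF U_measurable] by (intro nn_integral_mono)
    with Suc show ?case by (rule order_trans[rotated])
  qed
  note U_le = this
  define hit where "hit = {h \<in> space (hist_space n). \<exists>t\<le>n. A \<le> W h t}"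
  have sets: "hit \<in> sets (law n)"
    using hit_measurable[OF order_refl, of n] by (simp only: pred_def sets_law hit_def)
  have "ennreal A * emeasure (law n) hit = (\<integral>\<^sup>+h. ennreal A * indicator hit h \<partial>law n)"
    using sets by (simp add: nn_integral_cmult_indicator)
  also have "\<dots> \<le> (\<integral>\<^sup>+h. U n h \<partial>law n)"
    by (intro nn_integral_mono) (auto simp: hit_def U_def split: split_indicator)
  finally have "ennreal A * emeasure (law n) hit \<le> 1"
    using U_le[of n] by (rule order_trans)
  then have "ennreal (1 / A) * (ennreal A * emeasure (law n) hit) \<le> ennreal (1 / A) * 1"
    by (rule mult_left_mono) simp
  then show ?thesis
    using \<open>0 < A\<close> unfolding hit_def[symmetric]
    by (simp add: mult.assoc[symmetric] ennreal_mult[symmetric])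
qed

text \<open>Ville's inequality with the tilt tuned to exactly \<open>v\<close> pulls. Fewer pulls
  only lower the compensating term, so one tilt serves all times at once. The sign \<sigma> selects
  the upper or the lower tail.\<close>

lemma maximal_inequality:
  fixes \<sigma> x v :: real
  assumes "\<bar>\<sigma>\<bar> = 1" "0 \<le> x" "0 < v"
  shows "measure (law n) {h \<in> space (hist_space n). \<exists>t\<le>n. real (pulls h t j) \<le> v \<and> x \<le> \<sigma> * deviation \<mu> h t j}
    \<le> exp (- (x\<^sup>2 / (2 * v)))"
    (is "measure _ ?E \<le> _")
proof -
  interpret prob_space "law n" by (rule prob_space_law)
  \<comment> \<open>Up to the sign this maximises \<open>c * x - c\<^sup>2 / 2 * v\<close>; the
    maximum is the exponent \<open>x\<^sup>2 / (2 * v)\<close>.\<close>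
  define c where "c = x / v * \<sigma>"
  let ?W = "\<lambda>h t. exp (c * deviation \<mu> h t j - c\<^sup>2 / 2 * real (pulls h t j))"
  let ?hit = "{h \<in> space (hist_space n). \<exists>t\<le>n. exp (x\<^sup>2 / (2 * v)) \<le> ?W h t}"
  have "x\<^sup>2 / (2 * v) \<le> c * d - c\<^sup>2 / 2 * p" if "p \<le> v" "x \<le> \<sigma> * d" for p d
  proof -
    have "\<sigma>\<^sup>2 = 1"
      using assms(1) by (simp add: abs_square_eq_1)
    then have "c\<^sup>2 / 2 * p = (x / v)\<^sup>2 / 2 * p"
      by (simp add: c_def power_mult_distrib power_divide)
    also have "\<dots> \<le> (x / v)\<^sup>2 / 2 * v"
      using that by (intro mult_left_mono) auto
    also have "\<dots> = x\<^sup>2 / (2 * v)"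
      using assms(3) by (simp add: power2_eq_square)
    finally have "c\<^sup>2 / 2 * p \<le> x\<^sup>2 / (2 * v)" .
    moreover have "x / v * x \<le> x / v * (\<sigma> * d)"
      using that assms by (intro mult_left_mono) auto
    moreover have "x / v * x = 2 * (x\<^sup>2 / (2 * v))"
      by (simp add: power2_eq_square)
    moreover have "x / v * (\<sigma> * d) = c * d"
      by (simp add: c_def)
    ultimately show ?thesis by linarith
  qed
  note exponent = this
  have "?E \<subseteq> ?hit"
  proof
    fix h assume "h \<in> ?E"
    then obtain t where "h \<in> space (hist_space n)" "t \<le> n"
      "real (pulls h t j) \<le> v" "x \<le> \<sigma> * deviation \<mu> h t j"
      by blast
    moreover from this(3,4) have "exp (x\<^sup>2 / (2 * v)) \<le> ?W h t"
      by (intro exp_le_cancel_iff[THEN iffD2] exponent)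
    ultimately show "h \<in> ?hit" by blast
  qed
  have "emeasure (law n) ?hit \<le> ennreal (1 / exp (x\<^sup>2 / (2 * v)))"
    by (rule Ville_deviation) simp
  then have "measure (law n) ?hit \<le> 1 / exp (x\<^sup>2 / (2 * v))"
    by (simp add: emeasure_eq_measure)
  moreover have "measure (law n) ?E \<le> measure (law n) ?hit"
  proof (rule finite_measure_mono[OF \<open>?E \<subseteq> ?hit\<close>])
    have "?hit \<in> sets (hist_space n)"
      by (rule sets_ex_pulls_deviation[where
          P="\<lambda>p d. exp (x\<^sup>2 / (2 * v)) \<le> exp (c * d - c\<^sup>2 / 2 * real p)"]) measurable
    then show "?hit \<in> sets (law n)"
      by (simp only: sets_law)
  qed
  ultimately show ?thesis
    by (simp add: exp_minus inverse_eq_divide)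
qed

end

section \<open>Concentration of the index\<close>

text \<open>Comparison with the integral of \<open>2 * exp (- (u * a))\<close>, whose part between
  \<open>2 ^ k / 2\<close> and \<open>2 ^ k\<close> dominates term \<open>k\<close>. The second
  summand carried through the induction is the integral from \<open>2 ^ m / 2\<close> to
  infinity.\<close>

lemma sum_power2_exp_le:
  fixes a :: real
  assumes "0 < a"
  shows "(\<Sum>k<m. 2 ^ k * exp (- (2 ^ k * a))) \<le> 2 / a"
proof -
  have "(\<Sum>k<m. 2 ^ k * exp (- (2 ^ k * a))) + 2 / a * exp (- (2 ^ m * a / 2)) \<le> 2 / a"
  proof (induction m)
    case 0
    have "2 / a * exp (- (2 ^ 0 * a / 2)) \<le> 2 / a * 1"
      using assms by (intro mult_left_mono) auto
    then show ?case by simp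
  next
    case (Suc m)
    define y where "y = 2 ^ m * a / 2"
    have "exp (- (2 * y)) * (1 + y) \<le> exp (- (2 * y)) * exp y"
      by (intro mult_left_mono exp_ge_add_one_self) simp
    then have "2 / a * (exp (- (2 * y)) * (1 + y)) \<le> 2 / a * exp (- y)"
      using assms by (intro mult_left_mono) (auto simp: mult_exp_exp)
    moreover have "2 ^ m = 2 / a * y"
      using assms by (simp add: y_def)
    ultimately have "2 ^ m * exp (- (2 * y)) + 2 / a * exp (- (2 * y)) \<le> 2 / a * exp (- y)"
      by (simp add: algebra_simps)
    moreover have "2 ^ m * a = 2 * y" "2 ^ Suc m * a / 2 = 2 * y"
      by (simp_all add: y_def)
    ultimately show ?case
      using Suc unfolding y_def[symmetric] by simp
  qed
  moreover have "0 \<le> 2 / a * exp (- (2 ^ m * a / 2))"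
    using assms by simp
  ultimately show ?thesis by linarith
qed

text \<open>The same comparison with the integral of \<open>exp (- (u * a))\<close>; the induction
  carries its part from \<open>m\<close> to infinity.\<close>

lemma sum_exp_le:
  fixes a :: real
  assumes "0 < a"
  shows "(\<Sum>s=1..m. exp (- (real s * a))) \<le> 1 / a"
proof -
  have "(\<Sum>s=1..m. exp (- (real s * a))) + 1 / a * exp (- (real m * a)) \<le> 1 / a"
  proof (induction m)
    case (Suc m)
    have "1 / a * (exp (- (real (Suc m) * a)) * (1 + a)) \<le> 1 / a * (exp (- (real (Suc m) * a)) * exp a)"
      using assms by (intro mult_left_mono exp_ge_add_one_self) auto
    also have "\<dots> = 1 / a * exp (- (real m * a))"
      by (simp add: mult_exp_exp algebra_simps)
    finally have "exp (- (real (Suc m) * a)) + 1 / a * exp (- (real (Suc m) * a)) \<le> 1 / a * exp (- (real m * a))"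
      using assms by (simp add: field_simps)
    then show ?case
      using Suc by simp
  qed simp
  moreover have "0 \<le> 1 / a * exp (- (real m * a))"
    using assms by simp
  ultimately show ?thesis by linarith
qed

lemma log_plus_nonneg [simp]: "0 \<le> log_plus x"
  by (simp add: log_plus_def)

lemma log_plus_mono: "0 < x \<Longrightarrow> x \<le> y \<Longrightarrow> log_plus x \<le> log_plus y"
  unfolding log_plus_def by (intro max.mono order_refl ln_mono) auto

text \<open>Turns the logarithm inside the index into a factor of a tail probability.\<close>

lemma exp_minus_log_plus_le:
  assumes "0 < x"
  shows "exp (- log_plus x) \<le> 1 / x"
proof -
  have "exp (- log_plus x) \<le> exp (- ln x)"
    by (simp add: log_plus_def)
  also have "\<dots> = 1 / x"
    using assms by (simp add: exp_minus inverse_eq_divide)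
  finally show ?thesis .
qed

section \<open>Tail bounds for the index of one arm\<close>

context bandit
begin

text \<open>
  On the rounds in which the number of pulls lies in \<open>{2 ^ k..<2 * 2 ^ k}\<close>, the boundary
  is bounded from below by the constant \<open>b k\<close>.
\<close>

lemma prob_index_deficiency:
  fixes x N :: real
  assumes "0 < x" "0 < N"
  shows "measure (law n) {h \<in> space (hist_space n). \<exists>t\<le>n. 0 < pulls h t j \<and>
      real (pulls h t j) * x + sqrt (4 * real (pulls h t j) * log_plus (N / real (pulls h t j))) \<le> - deviation \<mu> h t j}
    \<le> 16 / (N * x\<^sup>2)"
    (is "measure _ ?E \<le> _")
proof -
  interpret prob_space "law n" by (rule prob_space_law)
  define b where "b k = 2 ^ k * x + sqrt (4 * 2 ^ k * log_plus (N / (2 * 2 ^ k)))" for k :: nat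
  define F where "F k = {h \<in> space (hist_space n). \<exists>t\<le>n. real (pulls h t j) \<le> 2 * 2 ^ k \<and>
    b k \<le> - 1 * deviation \<mu> h t j}" for k
  have F_sets: "F k \<in> sets (law n)" for k
    unfolding F_def sets_law
    by (rule sets_ex_pulls_deviation[where P="\<lambda>p d. real p \<le> 2 * 2 ^ k \<and> b k \<le> - 1 * d"]) measurable
  have "?E \<subseteq> (\<Union>k<Suc n. F k)"
  proof
    fix h assume "h \<in> ?E"
    then obtain t where h: "h \<in> space (hist_space n)" "t \<le> n" and p: "0 < pulls h t j" and
      d: "real (pulls h t j) * x + sqrt (4 * real (pulls h t j) * log_plus (N / real (pulls h t j))) \<le> - deviation \<mu> h t j"
      by blast
    obtain k where k: "2 ^ k \<le> pulls h t j" "pulls h t j < 2 ^ (k + 1)"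
      using ex_power_ivl1[of 2 "pulls h t j"] p by auto
    have rk: "2 ^ k \<le> real (pulls h t j)" "real (pulls h t j) \<le> 2 * 2 ^ k"
      using k of_nat_le_iff[of "2 ^ k" "pulls h t j", where 'a=real]
        of_nat_le_iff[of "pulls h t j" "2 ^ (k + 1)", where 'a=real] by auto
    have "k < Suc n"
      using k(1) pulls_le[of h t j] h(2) less_exp[of k] by linarith
    \<comment> \<open>The left end of the block enters the prefactors, the right end the logarithm,
      which decreases in the number of pulls.\<close>
    moreover have "b k \<le> real (pulls h t j) * x + sqrt (4 * real (pulls h t j) * log_plus (N / real (pulls h t j)))"
      unfolding b_def using rk p assms
      by (intro add_mono mult_right_mono real_sqrt_le_mono mult_mono log_plus_mono divide_left_mono) auto
    ultimately show "h \<in> (\<Union>k<Suc n. F k)"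
      using h rk d unfolding F_def by force
  qed
  then have "measure (law n) ?E \<le> measure (law n) (\<Union>k<Suc n. F k)"
    using F_sets by (intro finite_measure_mono) auto
  also have "\<dots> \<le> (\<Sum>k<Suc n. measure (law n) (F k))"
    using F_sets by (intro finite_measure_subadditive_finite) auto
  \<comment> \<open>In each block the linear part of the boundary yields the exponential and the
    logarithm yields the factor \<open>2 * 2 ^ k / N\<close>.\<close>
  also have "\<dots> \<le> (\<Sum>k<Suc n. 2 / N * (2 ^ k * exp (- (2 ^ k * (x\<^sup>2 / 4)))))"
  proof (rule sum_mono)
    fix k
    let ?L = "log_plus (N / (2 * 2 ^ k))"
    have b: "0 \<le> b k"
      using assms by (simp add: b_def)
    \<comment> \<open>The nonnegative cross term of the square is dropped.\<close>
    have "(2 ^ k * x)\<^sup>2 + 4 * 2 ^ k * ?L \<le> (b k)\<^sup>2"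
      using assms by (simp add: b_def power2_sum)
    then have "((2 ^ k * x)\<^sup>2 + 4 * 2 ^ k * ?L) / (2 * (2 * 2 ^ k)) \<le> (b k)\<^sup>2 / (2 * (2 * 2 ^ k))"
      by (rule divide_right_mono) simp
    moreover have "((2 ^ k * x)\<^sup>2 + 4 * 2 ^ k * ?L) / (2 * (2 * 2 ^ k)) = 2 ^ k * (x\<^sup>2 / 4) + ?L"
      by (simp add: power2_eq_square field_simps)
    ultimately have "exp (- ((b k)\<^sup>2 / (2 * (2 * 2 ^ k)))) \<le> exp (- (2 ^ k * (x\<^sup>2 / 4)) - ?L)"
      by simp
    also have "\<dots> = exp (- (2 ^ k * (x\<^sup>2 / 4))) * exp (- ?L)"
      by (simp add: mult_exp_exp)
    also have "\<dots> \<le> exp (- (2 ^ k * (x\<^sup>2 / 4))) * (1 / (N / (2 * 2 ^ k)))"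
      using assms by (intro mult_left_mono exp_minus_log_plus_le) auto
    also have "\<dots> = 2 / N * (2 ^ k * exp (- (2 ^ k * (x\<^sup>2 / 4))))"
      by simp
    finally show "measure (law n) (F k) \<le> 2 / N * (2 ^ k * exp (- (2 ^ k * (x\<^sup>2 / 4))))"
      using maximal_inequality[of "- 1" "b k" "2 * 2 ^ k" n j] b unfolding F_def by simp
  qed
  also have "\<dots> = 2 / N * (\<Sum>k<Suc n. 2 ^ k * exp (- (2 ^ k * (x\<^sup>2 / 4))))"
    by (rule sum_distrib_left[symmetric])
  also have "\<dots> \<le> 2 / N * (2 / (x\<^sup>2 / 4))"
    using assms by (intro mult_left_mono sum_power2_exp_le) auto
  also have "\<dots> = 16 / (N * x\<^sup>2)"
    by simp
  finally show ?thesis .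
qed

text \<open>For counts below a threshold \<open>r\<close> the probability is bounded by 1. From
  \<open>r\<close> on the exploration bonus is at most \<open>x / 2\<close>, so the deviation has to
  supply the other half, which has probability at most \<open>exp (- (s * x\<^sup>2 / 8))\<close>,
  summable in \<open>s\<close>.\<close>

lemma sum_prob_index_exceeds:
  fixes x N :: real
  assumes "0 < x" "0 < N"
  shows "(\<Sum>s=1..m. measure (law n) {h \<in> space (hist_space n). \<exists>t\<le>n. pulls h t j = s \<and>
      x \<le> deviation \<mu> h t j / real s + sqrt (4 / real s * log_plus (N / real s))})
    \<le> (8 + 16 * max 1 (ln (N * x\<^sup>2 / 16))) / x\<^sup>2"
    (is "(\<Sum>s=1..m. measure _ (?E s)) \<le> _")
proof -
  interpret prob_space "law n" by (rule prob_space_law)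
  \<comment> \<open>The maximum encodes two requirements on \<open>s \<ge> r\<close>:
    \<open>s \<ge> 16 / x\<^sup>2\<close> allows \<open>N / s\<close> to be replaced by
    \<open>N * x\<^sup>2 / 16\<close>, and the second bound makes the logarithm of the latter at
    most \<open>s * x\<^sup>2 / 16\<close>.\<close>
  define r where "r = 16 * max 1 (ln (N * x\<^sup>2 / 16)) / x\<^sup>2"
  have "0 \<le> r" by (simp add: r_def)
  have prob_le: "measure (law n) (?E s) \<le> (if real s < r then 1 else 0) + exp (- (real s * (x\<^sup>2 / 8)))"
    if "1 \<le> s" for s
  proof (cases "real s < r")
    case False
    have "16 * 1 / x\<^sup>2 \<le> r" "16 * ln (N * x\<^sup>2 / 16) / x\<^sup>2 \<le> r"
      unfolding r_def by (intro divide_right_mono mult_left_mono; simp)+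
    then have s: "16 / x\<^sup>2 \<le> real s" "16 * ln (N * x\<^sup>2 / 16) / x\<^sup>2 \<le> real s"
      using False by auto
    have "N / real s \<le> N * x\<^sup>2 / 16"
      using s(1) assms that by (simp add: field_simps)
    then have "ln (N / real s) \<le> ln (N * x\<^sup>2 / 16)"
      using assms that by (intro ln_mono) auto
    also have "\<dots> \<le> real s * x\<^sup>2 / 16"
      using s(2) assms by (simp add: field_simps)
    finally have "log_plus (N / real s) \<le> real s * x\<^sup>2 / 16"
      unfolding log_plus_def by (intro max.boundedI) auto
    then have "4 / real s * log_plus (N / real s) \<le> 4 / real s * (real s * x\<^sup>2 / 16)"
      by (intro mult_left_mono) auto
    also have "\<dots> = (x / 2)\<^sup>2"
      using that by (simp add: power2_eq_square)
    finally have "sqrt (4 / real s * log_plus (N / real s)) \<le> x / 2"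
      using assms by (intro real_le_lsqrt) auto
    then have "real s * x / 2 \<le> d" if "x \<le> d / real s + sqrt (4 / real s * log_plus (N / real s))" for d
    proof -
      have "x / 2 \<le> d / real s"
        using that \<open>sqrt _ \<le> x / 2\<close> by linarith
      then show ?thesis
        using \<open>1 \<le> s\<close> by (simp add: field_simps)
    qed
    then have "?E s \<subseteq> {h \<in> space (hist_space n). \<exists>t\<le>n. real (pulls h t j) \<le> real s \<and> real s * x / 2 \<le> 1 * deviation \<mu> h t j}"
      (is "_ \<subseteq> ?F")
      by fastforce
    moreover have "?F \<in> sets (law n)"
      unfolding sets_law
      by (rule sets_ex_pulls_deviation[where P="\<lambda>p d. real p \<le> real s \<and> real s * x / 2 \<le> 1 * d"]) measurable
    ultimately have "measure (law n) (?E s) \<le> measure (law n) ?F"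
      by (rule finite_measure_mono)
    also have "\<dots> \<le> exp (- ((real s * x / 2)\<^sup>2 / (2 * real s)))"
      using assms that by (intro maximal_inequality) auto
    also have "(real s * x / 2)\<^sup>2 / (2 * real s) = real s * (x\<^sup>2 / 8)"
      using that by (simp add: power2_eq_square)
    finally show ?thesis
      using False by simp
  qed (simp add: add_increasing2)
  have "(\<Sum>s=1..m. measure (law n) (?E s)) \<le>
      (\<Sum>s=1..m. (if real s < r then 1 else 0) + exp (- (real s * (x\<^sup>2 / 8))))"
    by (intro sum_mono prob_le) simp
  also have "\<dots> = real (card {s \<in> {1..m}. real s < r}) + (\<Sum>s=1..m. exp (- (real s * (x\<^sup>2 / 8))))"
    by (simp add: sum.distrib sum.If_cases Int_def)
  also have "\<dots> \<le> r + 1 / (x\<^sup>2 / 8)"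
  proof (intro add_mono sum_exp_le)
    have "{s \<in> {1..m}. real s < r} \<subseteq> {1..nat \<lfloor>r\<rfloor>}"
      by (auto simp: le_nat_floor)
    then have "card {s \<in> {1..m}. real s < r} \<le> nat \<lfloor>r\<rfloor>"
      using card_mono[of "{1..nat \<lfloor>r\<rfloor>}"] by fastforce
    then show "real (card {s \<in> {1..m}. real s < r}) \<le> r"
      using \<open>0 \<le> r\<close> by linarith
    show "0 < x\<^sup>2 / 8"
      using assms by simp
  qed
  also have "\<dots> = (8 + 16 * max 1 (ln (N * x\<^sup>2 / 16))) / x\<^sup>2"
    by (simp add: r_def add_divide_distrib)
  finally show ?thesis .
qed

end

text \<open>Here the shift pays for the logarithm: it forces \<open>y = x * sqrt N\<close> to be at
  least 1, and then the whole numerator is linear in \<open>y\<close>. The gap cancels one of the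
  two factors \<open>x\<close> of the denominator through \<open>\<Delta> \<le> 2 * x\<close>, and
  \<open>y / x = sqrt N\<close> is left.\<close>

lemma index_count_bound:
  fixes \<Delta> N :: real
  assumes "0 < \<Delta>" "0 < N"
  defines "x \<equiv> \<Delta> / 2 + sqrt (1 / N)"
  shows "\<Delta> * ((8 + 16 * max 1 (ln (N * x\<^sup>2 / 16))) / x\<^sup>2) \<le> 48 * sqrt N"
proof -
  define y where "y = x * sqrt N"
  have x: "0 < x" "\<Delta> \<le> 2 * x"
    using assms by (auto simp: x_def intro: add_pos_pos)
  have "sqrt (1 / N) * sqrt N \<le> y"
    unfolding y_def using assms by (intro mult_right_mono) (auto simp: x_def)
  then have y: "1 \<le> y"
    using assms by (simp add: real_sqrt_divide)
  have "N * x\<^sup>2 / 16 = (y / 4)\<^sup>2"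
    using assms by (simp add: y_def power_mult_distrib power_divide)
  then have "ln (N * x\<^sup>2 / 16) = 2 * ln (y / 4)"
    using y by (simp add: ln_realpow)
  also have "\<dots> \<le> 2 * (y / 4 - 1)"
    using y by (intro mult_left_mono ln_le_minus_one) auto
  \<comment> \<open>If the maximum is 1, the left side is 24; otherwise it is at most
    \<open>8 * y - 24\<close>.\<close>
  finally have "8 + 16 * max 1 (ln (N * x\<^sup>2 / 16)) \<le> 24 * y"
    using y by auto
  then have "\<Delta> * ((8 + 16 * max 1 (ln (N * x\<^sup>2 / 16))) / x\<^sup>2) \<le> 2 * x * (24 * y / x\<^sup>2)"
    using x assms y by (intro mult_mono divide_right_mono) auto
  also have "\<dots> = 48 * sqrt N"
    using x by (simp add: y_def power2_eq_square)
  finally show ?thesis .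
qed

section \<open>Regret of Unbalanced MOSS\<close>

text \<open>Different pulls of \<open>a\<close> happen at different values of its pull count. The
  additional 1 pays for the first pull, at count 0, where the index is infinite and carries no
  information.\<close>

lemma pulls_le_Suc_card:
  assumes "finite S"
    and S: "\<And>t. t < n \<Longrightarrow> fst (h t) = a \<Longrightarrow> pulls h t a \<noteq> 0 \<Longrightarrow> pulls h t a \<in> S"
  shows "pulls h n a \<le> Suc (card S)"
proof -
  let ?R = "{t. t < n \<and> fst (h t) = a}"
  have less: "pulls h s a < pulls h t a" if "s < t" "fst (h s) = a" for s t
    using pulls_mono[of "Suc s" t h a] that by (simp add: pulls_Suc)
  have "inj_on (\<lambda>t. pulls h t a) ?R"
  proof (rule inj_onI)
    fix s t assume "s \<in> ?R" "t \<in> ?R" "pulls h s a = pulls h t a"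
    then show "s = t"
      using less[of s t] less[of t s] by (cases s t rule: linorder_cases) auto
  qed
  then have "card ?R \<le> card (insert 0 S)"
    using assms by (intro card_inj_on_le) auto
  also have "\<dots> \<le> Suc (card S)"
    using assms(1) by (simp add: card_insert_if)
  finally show ?thesis
    by (simp add: pulls_def)
qed

lemma sum_pulls: "(\<Sum>a\<in>UNIV. real (pulls h n a)) = real n" for h :: "'k::finite history"
  using sum_rounds_eq_pulls[of "\<lambda>_. 1" h n] by simp

lemma measurable_umoss_index:
  fixes a :: "'k::finite"
  assumes "s \<le> t"
  shows "(\<lambda>h. umoss_index n B s h a) \<in> borel_measurable (hist_space t)"
proof -
  define f :: "nat \<Rightarrow> real \<Rightarrow> ereal" where
    "f p d = (if p = 0 \<or> B $ a = 0 then \<infinity> else ereal (d / real p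
      + sqrt (4 / real p * log_plus (umoss_n n B a / real p)) - sqrt (1 / umoss_n n B a)))" for p d
  \<comment> \<open>For the zero mean vector the deviation is the plain reward sum, so the index
    becomes a function of count and deviation.\<close>
  have "umoss_index n B s h a = f (pulls h s a) (deviation 0 h s a)" for h
    by (simp add: umoss_index_def f_def emp_mean_eq[of h s a 0])
  moreover have "(\<lambda>h. f (pulls h s a) (deviation 0 h s a)) \<in> borel_measurable (hist_space t)"
  proof (rule measurable_compose_countable[where f="\<lambda>p h. f p (deviation 0 h s a)"])
    show "(\<lambda>h. f p (deviation 0 h s a)) \<in> borel_measurable (hist_space t)" for p
      by (rule measurable_compose[OF measurable_deviation[OF assms], where g="f p"])
        (cases "p = 0 \<or> B $ a = 0"; simp add: f_def[abs_def])
  qed (rule measurable_pulls[OF assms])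
  ultimately show ?thesis by (simp only:)
qed

text \<open>If \<open>k\<close> is the last level with \<open>c * 2 ^ k \<le> z\<close>, the right
  side is \<open>c * 2 ^ Suc k\<close>, which exceeds \<open>z\<close> unless the levels are
  exhausted. This bounds a capped variable by finitely many indicators, so that tail bounds give its
  expectation.\<close>

lemma dyadic_sum_ge_min:
  fixes c z :: real
  assumes "0 \<le> c"
  shows "min z (c * 2 ^ Suc m) \<le> c + (\<Sum>k\<le>m. if c * 2 ^ k \<le> z then c * 2 ^ k else 0)"
proof (induction m)
  case 0
  have "(\<Sum>k\<le>0. if c * 2 ^ k \<le> z then c * 2 ^ k else 0) = (if c \<le> z then c else 0)"
    unfolding atMost_0 by simp
  then show ?case using assms by auto
next
  case (Suc m)
  then show ?case
    by (auto simp: min_def split: if_splits)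
qed

section \<open>From tail bounds to the regret\<close>

context bandit
begin

lemma AE_arg_max:
  assumes "unbalanced_MOSS n B \<pi>"
  shows "AE h in law n. \<forall>t<n. is_arg_max (umoss_index n B t h) (\<lambda>_. True) (fst (h t))"
proof (rule AE_law_arms)
  fix s t :: nat and a assume "s < t"
  then have "Measurable.pred (hist_space t) (\<lambda>h. \<not> umoss_index n B s h a < umoss_index n B s h b)" for b
    by (intro pred_intros_logic borel_measurable_pred_less measurable_umoss_index) auto
  then have "Measurable.pred (hist_space t) (\<lambda>h. \<forall>b. \<not> umoss_index n B s h a < umoss_index n B s h b)"
    by (rule pred_intros_countable)
  then show "Measurable.pred (hist_space t) (\<lambda>h. is_arg_max (umoss_index n B s h) (\<lambda>_. True) a)"
    by (simp only: is_arg_max_def simp_thms not_ex)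
next
  fix s a and h h' :: "'k history" assume eq: "\<And>u. u < s \<Longrightarrow> h u = h' u"
  have "umoss_index n B s h = umoss_index n B s h'"
    unfolding umoss_index_def fun_eq_iff using pulls_cong[OF eq] emp_mean_cong[OF eq] by (simp only:) simp
  then show "is_arg_max (umoss_index n B s h) (\<lambda>_. True) a = is_arg_max (umoss_index n B s h') (\<lambda>_. True) a"
    by (simp only:)
next
  fix s h a assume "s < n" "h \<in> space (hist_space s)" "a \<in> set_pmf (\<pi> s h)"
  then show "is_arg_max (umoss_index n B s h) (\<lambda>_. True) a"
    using assms unfolding unbalanced_MOSS_def by blast
qed

lemma prob_hist_space [simp]: "measure (law n) (space (hist_space n)) = 1"
  using prob_space.prob_space[OF prob_space_law[of n]] by simp

lemma integrable_arm: "t < n \<Longrightarrow> integrable (law n) (\<lambda>h. (f :: 'k \<Rightarrow> real) (fst (h t)))"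
proof -
  interpret prob_space "law n" by (rule prob_space_law)
  assume "t < n"
  show ?thesis
  proof (rule integrable_const_bound)
    show "AE h in law n. norm (f (fst (h t))) \<le> (\<Sum>a\<in>UNIV. \<bar>f a\<bar>)"
      unfolding real_norm_def by (intro AE_I2 member_le_sum[where f="\<lambda>a. \<bar>f a\<bar>"]) auto
    show "(\<lambda>h. f (fst (h t))) \<in> borel_measurable (law n)"
      unfolding borel_measurable_law
      by (rule measurable_compose[OF measurable_arm[OF \<open>t < n\<close>], where g=f]) simp
  qed
qed

lemma pseudo_regret_eq:
  "pseudo_regret n \<pi> D \<mu> i = (\<integral>h. (\<Sum>t<n. \<mu> $ i - \<mu> $ fst (h t)) \<partial>law n)"
proof -
  interpret prob_space "law n" by (rule prob_space_law)
  have "integrable (law n) (\<lambda>h. \<Sum>t<n. \<mu> $ fst (h t))"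
    by (intro Bochner_Integration.integrable_sum integrable_arm) simp
  then have "(\<integral>h. (real n * \<mu> $ i - (\<Sum>t<n. \<mu> $ fst (h t))) \<partial>law n) = pseudo_regret n \<pi> D \<mu> i"
    unfolding pseudo_regret_def by (subst Bochner_Integration.integral_diff) auto
  then show ?thesis
    by (simp add: sum_subtractf)
qed

text \<open>Serves the degenerate cases of admissibility: \<open>d = 1\<close> if
  \<open>B $ i\<close> reaches the horizon, \<open>d = 0\<close> for a single arm.\<close>

lemma pseudo_regret_le:
  assumes "\<And>j. \<mu> $ i - \<mu> $ j \<le> d"
  shows "pseudo_regret n \<pi> D \<mu> i \<le> real n * d"
proof -
  interpret prob_space "law n" by (rule prob_space_law)
  have "(\<integral>h. (\<Sum>t<n. \<mu> $ i - \<mu> $ fst (h t)) \<partial>law n) \<le> (\<integral>h. real n * d \<partial>law n)"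
  proof (rule integral_mono)
    show "integrable (law n) (\<lambda>h. \<Sum>t<n. \<mu> $ i - \<mu> $ fst (h t))"
      by (intro Bochner_Integration.integrable_sum integrable_arm) simp
    show "(\<Sum>t<n. \<mu> $ i - \<mu> $ fst (h t)) \<le> real n * d" for h
      using sum_mono[of "{..<n}" "\<lambda>t. \<mu> $ i - \<mu> $ fst (h t)" "\<lambda>_. d"] assms by simp
  qed simp
  then show ?thesis
    by (simp add: pseudo_regret_eq)
qed

text \<open>
  \<open>G\<close> is a dyadic upper bound on the minimum of 1 and the deficiency of the index of arm \<open>i\<close>, and
  \<open>H j\<close> is one plus the number of values of \<open>pulls h t j\<close> at which the index of arm \<open>j\<close> is too large.
\<close>

lemma pseudo_regret_unbalanced_MOSS:
  assumes "1 \<le> n" and moss: "unbalanced_MOSS n B \<pi>"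
    and B: "\<And>j. 0 < B $ j" "\<And>j. B $ j \<le> real n"
    and gap: "\<And>j. \<mu> $ i - \<mu> $ j \<le> 1"
    and sum_B: "(\<Sum>j\<in>UNIV - {i}. real n / B $ j) \<le> B $ i"
  shows "pseudo_regret n \<pi> D \<mu> i \<le> 75 * B $ i"
proof -
  interpret prob_space "law n" by (rule prob_space_law)
  define N where "N = umoss_n n B"
  have N: "0 < N j" "sqrt (N j) = real n / B $ j" "sqrt (1 / N j) = B $ j / real n" for j
    using B[of j] \<open>1 \<le> n\<close> by (simp_all add: N_def umoss_n_def real_sqrt_divide)
  define \<delta> where "\<delta> j = \<mu> $ i - \<mu> $ j" for j
  define \<epsilon> where "\<epsilon> = B $ i / real n"
  have \<epsilon>: "0 < \<epsilon>" "1 / N i = \<epsilon>\<^sup>2"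
    using B[of i] \<open>1 \<le> n\<close> by (simp_all add: \<epsilon>_def N_def umoss_n_def power_divide)
  \<comment> \<open>At level \<open>x\<close> the deficiency bound is
    \<open>16 * \<epsilon>\<^sup>2 / x\<^sup>2\<close>, which drops below 1 only beyond
    \<open>4 * \<epsilon>\<close>; the dyadic levels start there.\<close>
  define c where "c = 4 * \<epsilon>"
  have "0 < c" using \<epsilon> by (simp add: c_def)
  \<comment> \<open>Enough levels to reach 1; as no gap exceeds 1, the deficiency matters only up to
    1.\<close>
  obtain m where "1 / c < 2 ^ m"
    using real_arch_pow[of 2 "1 / c"] by auto
  then have m: "1 \<le> c * 2 ^ Suc m"
    using \<open>0 < c\<close> by (simp add: field_simps)

  define A where "A k = {h \<in> space (hist_space n). \<exists>t\<le>n. 0 < pulls h t i \<and>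
      real (pulls h t i) * (c * 2 ^ k) + sqrt (4 * real (pulls h t i) * log_plus (N i / real (pulls h t i)))
        \<le> - deviation \<mu> h t i}" for k :: nat
  have A_sets: "A k \<in> sets (law n)" for k
    unfolding A_def sets_law
    by (rule sets_ex_pulls_deviation[where P="\<lambda>p d. 0 < p \<and>
      real p * (c * 2 ^ k) + sqrt (4 * real p * log_plus (N i / real p)) \<le> - d"]) measurable
  define G where "G h = c + (\<Sum>k\<le>m. c * 2 ^ k * indicator (A k) h)" for h
  have G_ge: "c \<le> G h" for h
    using \<open>0 < c\<close> by (auto simp: G_def intro!: sum_nonneg)

  \<comment> \<open>What the unshifted index of a wrongly pulled arm must exceed its mean by: half
    the gap and the shift of that arm.\<close>
  define x where "x j = \<delta> j / 2 + sqrt (1 / N j)" for j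
  define E where "E j s = {h \<in> space (hist_space n). \<exists>t\<le>n. pulls h t j = s \<and>
      x j \<le> deviation \<mu> h t j / real s + sqrt (4 / real s * log_plus (N j / real s))}" for j s
  have E_sets: "E j s \<in> sets (law n)" for j s
    unfolding E_def sets_law
    by (rule sets_ex_pulls_deviation[where P="\<lambda>p d. p = s \<and>
      x j \<le> d / real s + sqrt (4 / real s * log_plus (N j / real s))"]) measurable
  define H where "H j h = 1 + (\<Sum>s=1..n. indicator (E j s) h :: real)" for j h
  have H_nonneg: "0 \<le> H j h" for j h
    by (auto simp: H_def intro!: add_nonneg_nonneg sum_nonneg)

  have deficiency: "min (- deviation \<mu> h t i / real p - sqrt (4 / real p * log_plus (N i / real p))) 1 \<le> G h"
    (is "min ?z 1 \<le> _") if "h \<in> space (hist_space n)" "t < n" "p = pulls h t i" "0 < p" for h t p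
  proof -
    have "min ?z 1 \<le> min ?z (c * 2 ^ Suc m)"
      using m by simp
    also have "\<dots> \<le> c + (\<Sum>k\<le>m. if c * 2 ^ k \<le> ?z then c * 2 ^ k else 0)"
      using \<open>0 < c\<close> by (intro dyadic_sum_ge_min) simp
    also have "\<dots> \<le> G h"
      unfolding G_def
    proof (intro add_left_mono sum_mono)
      fix k
      have "h \<in> A k" if "c * 2 ^ k \<le> ?z"
      proof -
        have "sqrt (4 * real p * log_plus (N i / real p)) = sqrt ((real p)\<^sup>2 * (4 / real p * log_plus (N i / real p)))"
          using \<open>0 < p\<close> by (simp add: power2_eq_square)
        also have "\<dots> = real p * sqrt (4 / real p * log_plus (N i / real p))"
          by (subst real_sqrt_mult) simp
        finally have "real p * (c * 2 ^ k) + sqrt (4 * real p * log_plus (N i / real p)) =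
            real p * (c * 2 ^ k + sqrt (4 / real p * log_plus (N i / real p)))"
          by (simp add: distrib_left)
        also have "\<dots> \<le> real p * (- deviation \<mu> h t i / real p)"
          using that by (intro mult_left_mono) auto
        also have "\<dots> = - deviation \<mu> h t i"
          using \<open>0 < p\<close> by simp
        finally show ?thesis
          unfolding A_def using \<open>h \<in> _\<close> \<open>t < n\<close> \<open>p = _\<close> \<open>0 < p\<close> less_imp_le by blast
      qed
      then show "(if c * 2 ^ k \<le> ?z then c * 2 ^ k else 0) \<le> c * 2 ^ k * indicator (A k) h"
        using \<open>0 < c\<close> by auto
    qed
    finally show ?thesis .
  qed

  \<comment> \<open>The maximising arm \<open>j\<close> has index at least that of \<open>i\<close>,
    hence at least \<open>\<mu> $ i - G h - \<epsilon>\<close>, which is more than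
    \<open>\<mu> $ i - \<delta> j / 2 = \<mu> $ j + \<delta> j / 2\<close>. Moving the shift of
    \<open>j\<close> to the other side gives \<open>x j\<close>.\<close>
  have exceeds: "h \<in> E j (pulls h t j)"
    if h: "h \<in> space (hist_space n)" "t < n" and opt: "is_arg_max (umoss_index n B t h) (\<lambda>_. True) (fst (h t))"
      and j: "fst (h t) = j" "pulls h t j \<noteq> 0" "2 * (G h + \<epsilon>) < \<delta> j" for h t j
  proof -
    define p where "p = pulls h t i"
    define s where "s = pulls h t j"
    have le: "umoss_index n B t h i \<le> umoss_index n B t h j"
      using opt j by (simp add: is_arg_max_def not_less)
    \<comment> \<open>An unpulled arm \<open>i\<close> would have infinite index, whereas that of
      \<open>j\<close> is finite.\<close>
    have "p \<noteq> 0"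
    proof
      assume "p = 0"
      then show False
        using le j(2) B(1)[of j] by (simp add: umoss_index_def p_def)
    qed
    then have "emp_mean h t i + sqrt (4 / real p * log_plus (N i / real p)) - sqrt (1 / N i) \<le>
        emp_mean h t j + sqrt (4 / real s * log_plus (N j / real s)) - sqrt (1 / N j)"
      using le j B(1)[of j] B(1)[of i] by (simp add: umoss_index_def p_def s_def N_def)
    moreover have "emp_mean h t i = \<mu> $ i + deviation \<mu> h t i / real p"
      "emp_mean h t j = \<mu> $ j + deviation \<mu> h t j / real s"
      using \<open>p \<noteq> 0\<close> j unfolding p_def s_def by (auto intro: emp_mean_eq)
    moreover have "min (- deviation \<mu> h t i / real p - sqrt (4 / real p * log_plus (N i / real p))) 1 \<le> G h"
      using h \<open>p \<noteq> 0\<close> by (intro deficiency) (auto simp: p_def)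
    \<comment> \<open>This removes the cap at 1: the minimum being at most \<open>G h < 1\<close>,
      the deficiency itself is at most \<open>G h\<close>.\<close>
    moreover have "G h < 1"
    proof -
      have "2 * (G h + \<epsilon>) < 1"
        using j(3) gap[of j] unfolding \<delta>_def by (rule less_le_trans)
      then have "2 * G h < 1"
        using \<epsilon>(1) by simp
      then show ?thesis by simp
    qed
    moreover have "sqrt (1 / N i) = \<epsilon>"
      by (simp add: N \<epsilon>_def)
    moreover have "G h + \<epsilon> < \<delta> j / 2" "\<mu> $ i - \<mu> $ j = \<delta> j" "x j = \<delta> j / 2 + sqrt (1 / N j)"
      using j(3) by (simp_all add: x_def \<delta>_def)
    ultimately have "x j \<le> deviation \<mu> h t j / real s + sqrt (4 / real s * log_plus (N j / real s))"
      by linarith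
    then show ?thesis
      unfolding E_def s_def using h less_imp_le by blast
  qed

  \<comment> \<open>Arms of gap at most \<open>2 * (G h + \<epsilon>)\<close> are charged that
    amount per pull, over \<open>n\<close> pulls in total. All pulls of an arm of larger gap are
    counted by \<open>H j\<close>.\<close>
  have pointwise: "(\<Sum>t<n. \<delta> (fst (h t))) \<le> 2 * real n * (G h + \<epsilon>) + (\<Sum>j\<in>UNIV - {i}. max 0 (\<delta> j) * H j h)"
    if h: "h \<in> space (hist_space n)"
      and opt: "\<forall>t<n. is_arg_max (umoss_index n B t h) (\<lambda>_. True) (fst (h t))" for h
  proof -
    have G_pos: "0 < G h + \<epsilon>"
      using G_ge[of h] \<open>0 < c\<close> \<epsilon>(1) by linarith
    have "\<delta> j * real (pulls h n j) \<le> 2 * (G h + \<epsilon>) * real (pulls h n j) + (if j = i then 0 else max 0 (\<delta> j) * H j h)"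
      for j
    proof (cases "\<delta> j \<le> 2 * (G h + \<epsilon>)")
      case True
      then have "\<delta> j * real (pulls h n j) \<le> 2 * (G h + \<epsilon>) * real (pulls h n j)"
        by (rule mult_right_mono) simp
      moreover have "0 \<le> (if j = i then 0 else max 0 (\<delta> j) * H j h)"
        using H_nonneg by simp
      ultimately show ?thesis by linarith
    next
      case False
      then have "j \<noteq> i"
        using G_pos by (auto simp: \<delta>_def)
      define S where "S = {s \<in> {1..n}. h \<in> E j s}"
      have "pulls h n j \<le> Suc (card S)"
      proof (rule pulls_le_Suc_card)
        fix t assume "t < n" "fst (h t) = j" "pulls h t j \<noteq> 0"
        moreover have "pulls h t j \<le> n"
          using pulls_le[of h t j] \<open>t < n\<close> by linarith
        ultimately show "pulls h t j \<in> S"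
          using exceeds[of h t j] h opt False by (auto simp: S_def)
      qed (simp add: S_def)
      also have "real (Suc (card S)) = H j h"
        by (simp add: H_def S_def indicator_def sum.If_cases Int_def)
      finally have "real (pulls h n j) \<le> H j h" by simp
      moreover have "0 < \<delta> j"
        using False G_pos by (intro less_trans[of 0 "2 * (G h + \<epsilon>)" "\<delta> j"]) auto
      ultimately have "\<delta> j * real (pulls h n j) \<le> max 0 (\<delta> j) * H j h"
        by (simp add: mult_left_mono)
      moreover have "0 \<le> 2 * (G h + \<epsilon>) * real (pulls h n j)"
        using G_pos by simp
      ultimately show ?thesis
        using \<open>j \<noteq> i\<close> by simp
    qed
    then have "(\<Sum>j\<in>UNIV. \<delta> j * real (pulls h n j)) \<le>
        (\<Sum>j\<in>UNIV. 2 * (G h + \<epsilon>) * real (pulls h n j) + (if j = i then 0 else max 0 (\<delta> j) * H j h))"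
      by (rule sum_mono)
    also have "\<dots> = 2 * (G h + \<epsilon>) * (\<Sum>j\<in>UNIV. real (pulls h n j)) +
        (\<Sum>j\<in>UNIV. if j = i then 0 else max 0 (\<delta> j) * H j h)"
      by (simp add: sum.distrib sum_distrib_left)
    also have "(\<Sum>j\<in>UNIV. if j = i then 0 else max 0 (\<delta> j) * H j h) = (\<Sum>j\<in>UNIV - {i}. max 0 (\<delta> j) * H j h)"
      by (rule sum.mono_neutral_cong_right) auto
    finally show ?thesis
      by (simp add: sum_rounds_eq_pulls sum_pulls mult_ac)
  qed

  have int_A: "integrable (law n) (indicator (A k) :: _ \<Rightarrow> real)" for k
    using A_sets by (simp add: integrable_indicator_iff emeasure_eq_measure)
  have int_E: "integrable (law n) (indicator (E j s) :: _ \<Rightarrow> real)" for j s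
    using E_sets by (simp add: integrable_indicator_iff emeasure_eq_measure)
  have int_G: "integrable (law n) G"
    unfolding G_def by (intro Bochner_Integration.integrable_add integrable_const
      Bochner_Integration.integrable_sum integrable_mult_right int_A)
  have int_H: "integrable (law n) (H j)" for j
    unfolding H_def by (intro Bochner_Integration.integrable_add integrable_const
      Bochner_Integration.integrable_sum int_E)

  have "expectation G = c + expectation (\<lambda>h. \<Sum>k\<le>m. c * 2 ^ k * indicator (A k) h)"
    unfolding G_def by (subst Bochner_Integration.integral_add)
      (simp_all del: sum_mult_indicator add: int_A Bochner_Integration.integrable_sum)
  also have "expectation (\<lambda>h. \<Sum>k\<le>m. c * 2 ^ k * indicator (A k) h) =
      (\<Sum>k\<le>m. expectation (\<lambda>h. c * 2 ^ k * indicator (A k) h))"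
    by (intro Bochner_Integration.integral_sum integrable_mult_right int_A)
  also have "\<dots> = (\<Sum>k\<le>m. c * 2 ^ k * measure (law n) (A k))"
    using A_sets sets.sets_into_space[of "A _" "law n"] by (simp add: Int_absorb2)
  \<comment> \<open>Level \<open>k\<close> contributes at most
    \<open>16 * \<epsilon>\<^sup>2 / (c * 2 ^ k)\<close>, a geometric series of total at most
    \<open>8 * \<epsilon>\<close>.\<close>
  also have "c + \<dots> \<le> c + (\<Sum>k\<le>m. 4 * \<epsilon> * (1 / 2) ^ k)"
  proof (intro add_left_mono sum_mono)
    fix k
    have "c * 2 ^ k * measure (law n) (A k) \<le> c * 2 ^ k * (16 / (N i * (c * 2 ^ k)\<^sup>2))"
      unfolding A_def using \<open>0 < c\<close> N(1) by (intro mult_left_mono prob_index_deficiency) auto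
    also have "\<dots> = 16 * (1 / N i) / (c * 2 ^ k)"
      using \<open>0 < c\<close> by (simp add: power2_eq_square)
    also have "\<dots> = 4 * \<epsilon> * (1 / 2) ^ k"
      using \<epsilon> by (simp add: c_def power2_eq_square power_divide)
    finally show "c * 2 ^ k * measure (law n) (A k) \<le> 4 * \<epsilon> * (1 / 2) ^ k" .
  qed
  also have "\<dots> = c + 4 * \<epsilon> * (\<Sum>k<Suc m. (1 / 2) ^ k)"
    by (simp only: sum_distrib_left lessThan_Suc_atMost)
  also have "\<dots> \<le> c + 4 * \<epsilon> * 2"
  proof (intro add_left_mono mult_left_mono)
    have "(\<Sum>k<Suc m. (1 / 2) ^ k) = 2 - 2 * (1 / 2 :: real) ^ Suc m"
      by (subst sum_gp_strict) simp
    also have "\<dots> \<le> 2" by simp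
    finally show "(\<Sum>k<Suc m. (1 / 2 :: real) ^ k) \<le> 2" .
  qed (use \<epsilon> in simp)
  finally have E_G: "expectation G \<le> 12 * \<epsilon>"
    by (simp add: c_def)

  \<comment> \<open>The first pull costs at most \<open>1 \<le> n / B $ j\<close>, the later ones at
    most \<open>48 * (n / B $ j)\<close>. Arms better than \<open>i\<close> contribute 0.\<close>
  have E_H: "max 0 (\<delta> j) * expectation (H j) \<le> 49 * (real n / B $ j)" for j
  proof (cases "0 < \<delta> j")
    case True
    have "0 < x j"
      using True N(1)[of j] by (simp add: x_def add_pos_pos)
    have "expectation (H j) = 1 + (\<Sum>s=1..n. measure (law n) (E j s))"
      unfolding H_def using E_sets int_E by simp
    also have "\<dots> \<le> 1 + (8 + 16 * max 1 (ln (N j * (x j)\<^sup>2 / 16))) / (x j)\<^sup>2"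
      unfolding E_def using \<open>0 < x j\<close> N(1) by (intro add_left_mono sum_prob_index_exceeds)
    finally have "\<delta> j * expectation (H j) \<le> \<delta> j * (1 + (8 + 16 * max 1 (ln (N j * (x j)\<^sup>2 / 16))) / (x j)\<^sup>2)"
      using True by (intro mult_left_mono) auto
    also have "\<dots> = \<delta> j + \<delta> j * ((8 + 16 * max 1 (ln (N j * (x j)\<^sup>2 / 16))) / (x j)\<^sup>2)"
      by (simp only: distrib_left mult_1_right)
    also have "\<dots> \<le> 1 + 48 * sqrt (N j)"
      unfolding x_def using True N(1) gap[of j] by (intro add_mono index_count_bound) (auto simp: \<delta>_def)
    also have "1 + 48 * sqrt (N j) \<le> 49 * (real n / B $ j)"
    proof -
      have "1 \<le> real n / B $ j"
        using B[of j] by simp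
      then show ?thesis
        unfolding N(2) by linarith
    qed
    finally show ?thesis
      using True by simp
  next
    case False
    then show ?thesis
      using B(1)[of j] by (simp add: max_def less_imp_le)
  qed

  have "pseudo_regret n \<pi> D \<mu> i = (\<integral>h. (\<Sum>t<n. \<delta> (fst (h t))) \<partial>law n)"
    by (simp add: pseudo_regret_eq \<delta>_def)
  also have "\<dots> \<le> (\<integral>h. 2 * real n * (G h + \<epsilon>) + (\<Sum>j\<in>UNIV - {i}. max 0 (\<delta> j) * H j h) \<partial>law n)"
  proof (rule integral_mono_AE)
    show "integrable (law n) (\<lambda>h. \<Sum>t<n. \<delta> (fst (h t)))"
      by (intro Bochner_Integration.integrable_sum integrable_arm) simp
    show "integrable (law n) (\<lambda>h. 2 * real n * (G h + \<epsilon>) + (\<Sum>j\<in>UNIV - {i}. max 0 (\<delta> j) * H j h))"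
      by (intro Bochner_Integration.integrable_add integrable_const int_G int_H
        Bochner_Integration.integrable_sum integrable_mult_right)
    show "AE h in law n. (\<Sum>t<n. \<delta> (fst (h t))) \<le>
        2 * real n * (G h + \<epsilon>) + (\<Sum>j\<in>UNIV - {i}. max 0 (\<delta> j) * H j h)"
      using AE_arg_max[OF moss] AE_space
    proof eventually_elim
      case (elim h)
      then show ?case by (intro pointwise) simp_all
    qed
  qed
  also have "\<dots> = 2 * real n * (expectation G + \<epsilon>) + (\<Sum>j\<in>UNIV - {i}. max 0 (\<delta> j) * expectation (H j))"
    using int_G int_H by simp
  also have "\<dots> \<le> 2 * real n * (12 * \<epsilon> + \<epsilon>) + (\<Sum>j\<in>UNIV - {i}. 49 * (real n / B $ j))"
    using E_G E_H by (intro add_mono mult_left_mono sum_mono) auto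
  \<comment> \<open>Since \<open>n * \<epsilon> = B $ i\<close>, the factor 26 is
    \<open>2 * (12 + 1)\<close>; admissibility then bounds the remaining sum by
    \<open>B $ i\<close>.\<close>
  also have "\<dots> = 26 * B $ i + 49 * (\<Sum>j\<in>UNIV - {i}. real n / B $ j)"
    using \<open>1 \<le> n\<close> by (simp add: \<epsilon>_def sum_distrib_left)
  also have "\<dots> \<le> 75 * B $ i"
    using sum_B by simp
  finally show ?thesis .
qed

end

text \<open>If \<open>B $ i < n\<close>, the sum must be the smaller side of the minimum. It is then
  finite, so every other \<open>B $ j\<close> is positive, and having at least one positive term it
  makes \<open>B $ i\<close> positive too. A single arm is kept apart, because there the sum is
  empty and \<open>B $ i\<close> may be 0.\<close>

lemma admissible_bounds_cases:
  fixes B :: "real ^ 'k::finite"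
  assumes "1 \<le> n" and B: "B \<in> admissible_bounds n"
  obtains (trivial) "real n \<le> B $ i"
    | (single) "UNIV = {i}" "0 \<le> B $ i"
    | (sum) "\<And>j. 0 < B $ j" "\<And>j. B $ j \<le> real n" "(\<Sum>j\<in>UNIV - {i}. real n / B $ j) \<le> B $ i"
proof -
  have B_range: "0 \<le> B $ j" "B $ j \<le> real n" for j
    using B by (auto simp: admissible_bounds_def)
  consider "real n \<le> B $ i" | "UNIV = {i}" | "B $ i < real n" "UNIV \<noteq> {i}"
    by linarith
  then show thesis
  proof cases
    case 3
    have "min (ereal (real n)) (\<Sum>j\<in>UNIV - {i}. ereal (real n) / ereal (B $ j)) \<le> ereal (B $ i)"
      using B by (simp add: admissible_bounds_def)
    then have sum_le: "(\<Sum>j\<in>UNIV - {i}. ereal (real n) / ereal (B $ j)) \<le> ereal (B $ i)"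
      using 3 by (auto simp: min_def split: if_splits)
    have pos: "0 < B $ j" if "j \<noteq> i" for j
    proof (rule ccontr)
      assume "\<not> 0 < B $ j"
      then have "ereal (real n) / ereal (B $ j) = \<infinity>"
        using B_range(1)[of j] \<open>1 \<le> n\<close> by simp
      moreover have "ereal (real n) / ereal (B $ j) \<le> (\<Sum>j\<in>UNIV - {i}. ereal (real n) / ereal (B $ j))"
        using that B_range(1) \<open>1 \<le> n\<close>
        by (subst sum.remove[of _ j]) (auto simp: divide_ereal_def ereal_inverse_nonneg_iff intro!: add_increasing2 sum_nonneg)
      ultimately show False
        using sum_le by simp
    qed
    have "ereal (real n) / ereal (B $ j) = ereal (real n / B $ j)" if "j \<noteq> i" for j
      using pos[OF that] by simp
    then have "(\<Sum>j\<in>UNIV - {i}. ereal (real n) / ereal (B $ j)) = (\<Sum>j\<in>UNIV - {i}. ereal (real n / B $ j))"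
      by (intro sum.cong) auto
    then have sum_real: "(\<Sum>j\<in>UNIV - {i}. real n / B $ j) \<le> B $ i"
      using sum_le by simp
    obtain j where "j \<noteq> i"
      using 3(2) by auto
    then have "0 < real n / B $ j"
      using pos \<open>1 \<le> n\<close> by simp
    also have "\<dots> \<le> (\<Sum>j\<in>UNIV - {i}. real n / B $ j)"
      using \<open>j \<noteq> i\<close> B_range(1) by (intro member_le_sum) auto
    also note sum_real
    finally have "0 < B $ i" .
    then have "0 < B $ j" for j
      using pos by (cases "j = i") auto
    then show thesis
      using B_range(2) sum_real by (intro sum)
  qed (use trivial single B_range in auto)
qed

theorem theorem2:
  fixes B :: "real ^ 'k::finite"
    and n :: nat
    and \<pi> :: "'k policy"
    and \<nu> :: "real ^ 'k \<Rightarrow> 'k \<Rightarrow> real measure"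
  assumes "n \<ge> 1"
    and "B \<in> admissible_bounds n"
    and "unbalanced_MOSS n B \<pi>"
    and "\<And>\<mu> a. \<mu> \<in> mean_vectors \<Longrightarrow> noise_distribution (\<nu> \<mu> a)"
  shows "\<forall>i. worst_regret n \<pi> \<nu> i \<le> ereal (252 * B $ i)"
proof
  fix i
  have "pseudo_regret n \<pi> (\<nu> \<mu>) \<mu> i \<le> 252 * B $ i" if "\<mu> \<in> mean_vectors" for \<mu>
  proof -
    interpret bandit \<pi> \<mu> "\<nu> \<mu>"
      using assms that by unfold_locales (auto simp: unbalanced_MOSS_def)
    have gap: "\<mu> $ i - \<mu> $ j \<le> 1" for j
      using that by (simp add: mean_vectors_def)
    from assms(1,2) show ?thesis
    proof (cases rule: admissible_bounds_cases[where i=i])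
      case trivial
      then show ?thesis
        using pseudo_regret_le[of i 1 n] gap by simp
    next
      \<comment> \<open>With \<open>B $ i = 0\<close> possible, the regret has to be at most 0
        exactly.\<close>
      case single
      then have "\<mu> $ i - \<mu> $ j \<le> 0" for j
        using UNIV_I[of j] unfolding single(1) by simp
      then show ?thesis
        using pseudo_regret_le[of i 0 n] single by simp
    next
      case sum
      then have "pseudo_regret n \<pi> (\<nu> \<mu>) \<mu> i \<le> 75 * B $ i"
        using assms gap by (intro pseudo_regret_unbalanced_MOSS)
      then show ?thesis
        using sum(1)[of i] by simp
    qed
  qed
  then show "worst_regret n \<pi> \<nu> i \<le> ereal (252 * B $ i)"
    unfolding worst_regret_def by (intro SUP_least) simp
qed

end
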